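(* There is an absolute constant $C>0$ such that the following holds. Let $G=(V,E)$ be an $(n,d,\lambda)$-expander with $n\ge2$, $d$ even, and $\mathrm{girth}(G)=g$. Then for every rule $\mathcal{R}$ and every starting vertex, the greedy random walk on $G$ satisfies \[ \mathbb{E}[C_E(G)] \le |E| + C\,|E|\cdot\frac{\log n}{(1-\lambda)\,g}. \] In particular, for a family of such graphs with constant even degree $d$, $\lambda$ bounded away from $1$, and $\mathrm{girth}(G)=\Omega(\log n)$, the expected edge cover time is $O(n)$.
   Context: A greedy random walk (GRW) on a connected locally finite graph $G=(V,E)$ with rule $\mathcal{R}$ started at $v_0$: $X_0=v_0$; with $H_t=\{\{X_{s-1},X_s\}:0<s\le t\}$ and $J_t(v)=\{e\in E: v\in e, e\notin H_t\}$, if $J_t(X_t)\ne\emptyset$ then $X_{t+1}=w$ for some $w$ with $\{X_t,w\}\in J_t(X_t)$, chosen according to an arbitrary (possibly randomized, history-dependent) rule $\mathcal{R}$; if $J_t(X_t)=\emptyset$ then $X_{t+1}$ is a uniformly random neighbor of $X_t$. $C_E(G)=\min\{t:H_t=E\}$ is the edge cover time. For a $d$-regular graph on $n$ vertices with normalized adjacency matrix $A$ ($A(u,v)=1/d$ if $\{u,v\}\in E$, else $0$) and eigenvalues $1=\lambda_1\ge\dots\ge\lambda_n\ge-1$, set $\lambda(G)=\max_{2\le i\le n}|\lambda_i|$; $G$ is an $(n,d,\lambda)$-expander if $\lambda(G)<\lambda<1$. $\mathrm{girth}(G)$ is the minimal length of a cycle in $G$. *)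

theory Defs
  imports "HOL-Probability.Probability" "Jordan_Normal_Form.Char_Poly"
begin

definition simple_graph :: "nat \<Rightarrow> nat set set \<Rightarrow> bool" where
  "simple_graph n E \<longleftrightarrow> (\<forall>e\<in>E. \<exists>u v. e = {u, v} \<and> u \<noteq> v \<and> u < n \<and> v < n)"

definition regular :: "nat \<Rightarrow> nat set set \<Rightarrow> nat \<Rightarrow> bool" where
  "regular n E d \<longleftrightarrow> (\<forall>v<n. card {e\<in>E. v \<in> e} = d)"

definition neighbors :: "nat set set \<Rightarrow> nat \<Rightarrow> nat set" where
  "neighbors E v = {w. {v, w} \<in> E}"

definition norm_adj :: "nat \<Rightarrow> nat set set \<Rightarrow> nat \<Rightarrow> real mat" where
  "norm_adj n E d = mat n n (\<lambda>(u, v). if {u, v} \<in> E then 1 / real d else 0)"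

text \<open>The eigenvalues of A, with multiplicity: the roots of its characteristic
  polynomial (A is real symmetric, so all n of them are real).\<close>

definition adj_eigenvalues :: "nat \<Rightarrow> nat set set \<Rightarrow> nat \<Rightarrow> real multiset" where
  "adj_eigenvalues n E d = proots (char_poly (norm_adj n E d))"

text \<open>lambda(G) = max over i \<ge> 2 of |lambda_i|, where lambda_1 = 1 is the top eigenvalue:
  remove one copy of the eigenvalue 1 and take the maximal absolute value of the rest.\<close>

definition spec_lambda :: "nat \<Rightarrow> nat set set \<Rightarrow> nat \<Rightarrow> real" where
  "spec_lambda n E d = Max ((\<lambda>x. \<bar>x\<bar>) ` set_mset (adj_eigenvalues n E d - {#1#}))"

definition expander :: "nat \<Rightarrow> nat set set \<Rightarrow> nat \<Rightarrow> real \<Rightarrow> bool" where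
  "expander n E d lam \<longleftrightarrow> simple_graph n E \<and> regular n E d \<and>
     spec_lambda n E d < lam \<and> lam < 1"

definition is_cycle :: "nat set set \<Rightarrow> nat list \<Rightarrow> bool" where
  "is_cycle E c \<longleftrightarrow> length c \<ge> 3 \<and> distinct c \<and>
     (\<forall>i<length c. {c ! i, c ! ((i + 1) mod length c)} \<in> E)"

definition girth :: "nat set set \<Rightarrow> nat" where
  "girth E = (LEAST k. \<exists>c. is_cycle E c \<and> length c = k)"

text \<open>A history is the list [X_0, ..., X_t] of visited vertices.\<close>

definition traversed :: "nat list \<Rightarrow> nat set set" where
  "traversed h = {{h ! (s - 1), h ! s} | s. 0 < s \<and> s < length h}"

definition unused :: "nat set set \<Rightarrow> nat list \<Rightarrow> nat set set" where
  "unused E h = {e\<in>E. last h \<in> e \<and> e \<notin> traversed h}"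

definition admissible_rule :: "nat set set \<Rightarrow> (nat list \<Rightarrow> nat pmf) \<Rightarrow> bool" where
  "admissible_rule E R \<longleftrightarrow>
     (\<forall>h. h \<noteq> [] \<longrightarrow> unused E h \<noteq> {} \<longrightarrow>
        set_pmf (R h) \<subseteq> {w. {last h, w} \<in> unused E h})"

definition grw_step :: "nat set set \<Rightarrow> (nat list \<Rightarrow> nat pmf) \<Rightarrow> nat list \<Rightarrow> nat pmf" where
  "grw_step E R h = (if unused E h \<noteq> {} then R h else pmf_of_set (neighbors E (last h)))"

fun grw :: "nat set set \<Rightarrow> (nat list \<Rightarrow> nat pmf) \<Rightarrow> nat \<Rightarrow> nat \<Rightarrow> nat list pmf" where
  "grw E R v0 0 = return_pmf [v0]"
| "grw E R v0 (Suc t) = grw E R v0 t \<bind> (\<lambda>h. map_pmf (\<lambda>w. h @ [w]) (grw_step E R h))"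

text \<open>C_E > t iff H_s \<noteq> E for all s \<le> t (H_s is the traversed edge set of the prefix
  [X_0, ..., X_s]).  Expected edge cover time E[C_E] = sum over t \<ge> 0 of P(C_E > t)
  (expectation of a nonnegative integer random variable, possibly infinite).\<close>

definition not_covered_by :: "nat set set \<Rightarrow> nat \<Rightarrow> nat list \<Rightarrow> bool" where
  "not_covered_by E t h \<longleftrightarrow> (\<forall>s\<le>t. traversed (take (Suc s) h) \<noteq> E)"

definition expected_edge_cover_time ::
  "nat set set \<Rightarrow> (nat list \<Rightarrow> nat pmf) \<Rightarrow> nat \<Rightarrow> ennreal" where
  "expected_edge_cover_time E R v0 =
     (\<Sum>t. ennreal (measure_pmf.prob (grw E R v0 t) {h. not_covered_by E t h}))"

end

theory Submission
  imports Defs "Jordan_Normal_Form.Schur_Decomposition"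
begin

text \<open>
  All degrees are even, so a greedy phase can only get stuck at the vertex where it started: it is a
  closed trail and uses at least $g$ edges, and the unused edges again form an even graph.  Hence if
  a random phase starts with $u$ unused edges, at most $u / g$ random phases are still to come.

  A random phase is a simple random walk run until it hits the set $S$ of vertices incident to an
  unused edge.  By the spectral gap this takes expected time
  $O((\log n + n / |S|) / (1 - \lambda))$: after $\log n / (1 - \lambda)$ steps the walk is mixed, and
  from the stationary distribution it hits $S$ at rate $(1 - \lambda) |S| / n$.  As
  $|S| \ge 2 u / d$ and the values of $u$ seen backwards in time grow at least like $g, 2 g, 3 g, \dots$,
  the terms $n / |S|$ sum to a harmonic series and contribute only $O(|E| \log n / g)$.
\<close>

unbundle no vec_syntax

section \<open>Traces of powers of symmetric matrices\<close>

text \<open>The gap is given through the multiset of roots of the characteristic polynomial, while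
  the walk needs a norm contraction on mean-zero functions. Traces connect the two: the trace of an
  even power is a power sum of the roots and, by symmetry, also the squared Frobenius norm of a
  power of \<open>A\<close>. The rule may depend on the whole history, so the greedy walk is no
  Markov chain on the vertices. The cost bound is therefore proved for all histories at once, by
  induction on a time horizon, through two interlocking statements: \<open>stuck_bound\<close>
  inside a random phase and \<open>greedy_bound\<close> inside a greedy one. The latter carries the
  set \<open>P\<close> of edges of the current phase, so that
  \<open>card (remaining h) + card P\<close> stays constant until the phase ends and only then
  drops, by at least \<open>g\<close>. The constant 11 is 3 + 2 * 4: each random phase pays 3 ln n
  for mixing and rounding, and the harmonic sum, which enters with factor 2, is at most 4 ln
  n.\<close>

definition mat_trace :: "real mat \<Rightarrow> real" where
  "mat_trace A = (\<Sum>i<dim_row A. A $$ (i, i))"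

lemma mat_mult_entry:
  fixes A B :: "'a::semiring_0 mat"
  assumes "A \<in> carrier_mat n n" "B \<in> carrier_mat n n" "i < n" "j < n"
  shows "(A * B) $$ (i, j) = (\<Sum>k<n. A $$ (i, k) * B $$ (k, j))"
  using assms by (simp add: scalar_prod_def atLeast0LessThan)

lemma mat_trace_comm:
  assumes "A \<in> carrier_mat n n" "B \<in> carrier_mat n n"
  shows "mat_trace (A * B) = mat_trace (B * A)"
proof -
  have "mat_trace (A * B) = (\<Sum>i<n. \<Sum>k<n. A $$ (i, k) * B $$ (k, i))"
    using assms by (auto simp: mat_trace_def mat_mult_entry simp del: index_mult_mat(1) intro!: sum.cong)
  also have "\<dots> = (\<Sum>k<n. \<Sum>i<n. B $$ (k, i) * A $$ (i, k))"
    by (subst sum.swap) (simp add: mult.commute)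
  also have "\<dots> = mat_trace (B * A)"
    using assms by (auto simp: mat_trace_def mat_mult_entry simp del: index_mult_mat(1) intro!: sum.cong)
  finally show ?thesis .
qed

lemma mat_trace_similar:
  assumes "A \<in> carrier_mat n n" "similar_mat_wit A B P Q"
  shows "mat_trace A = mat_trace B"
proof -
  note w = similar_mat_witD2[OF assms]
  have "mat_trace A = mat_trace (P * (B * Q))"
    using w by (simp add: assoc_mult_mat[of _ n n _ n _ n])
  also have "\<dots> = mat_trace (B * Q * P)"
    using w by (intro mat_trace_comm) auto
  also have "B * Q * P = B"
    using w by (simp add: assoc_mult_mat[of _ n n _ n _ n])
  finally show ?thesis .
qed

lemma upper_triangular_pow:
  assumes B: "(B :: real mat) \<in> carrier_mat n n" and ut: "upper_triangular B"
  shows "upper_triangular (B ^\<^sub>m k) \<and> (\<forall>i<n. (B ^\<^sub>m k) $$ (i, i) = (B $$ (i, i)) ^ k)"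
proof (induction k)
  case 0
  then show ?case using B by auto
next
  case (Suc k)
  have C: "B ^\<^sub>m k \<in> carrier_mat n n" using B by simp
  have e: "(B ^\<^sub>m Suc k) $$ (i, j) = (\<Sum>l<n. (B ^\<^sub>m k) $$ (i, l) * B $$ (l, j))" if "i < n" "j < n" for i j
    using mat_mult_entry[OF C B that] by simp
  have z1: "(B ^\<^sub>m k) $$ (i, l) = 0" if "l < i" "i < n" for i l
    using Suc that C by (auto simp: upper_triangular_def)
  have z2: "B $$ (i, l) = 0" if "l < i" "i < n" for i l
    using ut that B by (auto simp: upper_triangular_def)
  have "(B ^\<^sub>m Suc k) $$ (i, j) = 0" if "j < i" "i < n" for i j
    unfolding e[OF that(2) less_trans[OF that]]
  proof (rule sum.neutral, safe)
    fix l assume "l < n"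
    then show "(B ^\<^sub>m k) $$ (i, l) * B $$ (l, j) = 0"
      using z1[of l i] z2[of j l] that by (cases "l < i") auto
  qed
  moreover have "(B ^\<^sub>m Suc k) $$ (i, i) = B $$ (i, i) ^ Suc k" if "i < n" for i
  proof -
    have "(\<Sum>l<n. (B ^\<^sub>m k) $$ (i, l) * B $$ (l, i)) = (\<Sum>l<n. if l = i then (B $$ (i, i)) ^ Suc k else 0)"
    proof (intro sum.cong refl)
      fix l assume "l \<in> {..<n}"
      then show "(B ^\<^sub>m k) $$ (i, l) * B $$ (l, i) = (if l = i then (B $$ (i, i)) ^ Suc k else 0)"
        using z1[of l i] z2[of i l] that Suc by (cases l i rule: linorder_cases) auto
    qed
    then show ?thesis using e[OF that that] that by simp
  qed
  ultimately show ?case using B by (auto simp: upper_triangular_def)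
qed

text \<open>The Schur form \<open>B\<close> is similar to \<open>A\<close> with diagonal
  \<open>es\<close>. Trace is invariant under similarity, and powers of a triangular matrix have the
  powers of the entries on the diagonal.\<close>

lemma mat_trace_pow:
  assumes A: "(A :: real mat) \<in> carrier_mat n n"
    and c: "char_poly A = (\<Prod>e\<leftarrow>es. [:- e, 1:])"
  shows "mat_trace (A ^\<^sub>m k) = (\<Sum>e\<leftarrow>es. e ^ k)"
proof -
  obtain B P Q where s: "schur_decomposition A es = (B, P, Q)"
    by (metis prod_cases3)
  from schur_decomposition[OF A c s]
  have w: "similar_mat_wit A B P Q" and ut: "upper_triangular B" and d: "diag_mat B = es" by auto
  have B: "B \<in> carrier_mat n n" using similar_mat_witD2[OF A w] by auto
  have "mat_trace (A ^\<^sub>m k) = mat_trace (B ^\<^sub>m k)"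
    using A by (intro mat_trace_similar[OF _ similar_mat_wit_pow[OF w]]) auto
  also have "\<dots> = (\<Sum>i<n. (B $$ (i, i)) ^ k)"
    using upper_triangular_pow[OF B ut, of k] B by (auto simp: mat_trace_def)
  also have "\<dots> = (\<Sum>e\<leftarrow>diag_mat B. e ^ k)"
    using B by (simp add: diag_mat_def comp_def interv_sum_list_conv_sum_set_nat atLeast0LessThan)
  finally show ?thesis using d by simp
qed

text \<open>The Hermitian form \<open>q\<close> of an eigenvector equals its own conjugate because
  the matrix is real symmetric, and it also equals \<open>e\<close> times the positive squared norm
  \<open>N\<close>.\<close>

lemma symmetric_eigenvalue_real:
  assumes A: "(A :: real mat) \<in> carrier_mat n n"
    and sym: "\<And>i j. i < n \<Longrightarrow> j < n \<Longrightarrow> A $$ (i, j) = A $$ (j, i)"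
    and ev: "eigenvalue (map_mat complex_of_real A) e"
  shows "Im e = 0"
proof -
  let ?M = "map_mat complex_of_real A"
  obtain v where v: "v \<in> carrier_vec n" "v \<noteq> 0\<^sub>v n" "?M *\<^sub>v v = e \<cdot>\<^sub>v v"
    using ev A by (auto simp: eigenvalue_def eigenvector_def)
  have row: "(\<Sum>j<n. A $$ (i, j) * v $ j) = e * v $ i" if "i < n" for i
  proof -
    have "(\<Sum>j<n. A $$ (i, j) * v $ j) = (?M *\<^sub>v v) $ i"
      using that A v(1) by (simp add: scalar_prod_def atLeast0LessThan)
    also have "\<dots> = e * v $ i" using v(1) that by (simp add: v(3))
    finally show ?thesis .
  qed
  define q where "q = (\<Sum>i<n. \<Sum>j<n. cnj (v $ i) * A $$ (i, j) * v $ j)"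
  define N where "N = (\<Sum>i<n. (cmod (v $ i))\<^sup>2)"
  have q1: "q = e * complex_of_real N"
  proof -
    have "q = (\<Sum>i<n. cnj (v $ i) * (\<Sum>j<n. A $$ (i, j) * v $ j))"
      unfolding q_def by (simp add: sum_distrib_left mult.assoc)
    also have "\<dots> = (\<Sum>i<n. cnj (v $ i) * (e * v $ i))"
      by (intro sum.cong refl arg_cong2[where f = "(*)"]) (auto simp: row)
    also have "\<dots> = e * complex_of_real N"
      unfolding N_def of_real_sum sum_distrib_left
      by (intro sum.cong refl) (simp add: complex_norm_square mult_ac del: of_real_power)
    finally show ?thesis .
  qed
  have "cnj q = (\<Sum>i<n. \<Sum>j<n. v $ i * A $$ (i, j) * cnj (v $ j))"
    unfolding q_def by (simp add: cnj_sum)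
  also have "\<dots> = (\<Sum>j<n. \<Sum>i<n. v $ i * A $$ (i, j) * cnj (v $ j))"
    by (rule sum.swap)
  also have "\<dots> = q"
    unfolding q_def by (intro sum.cong refl) (simp add: sym mult_ac)
  finally have "Im (cnj q) = Im q" by simp
  then have "Im q = 0" by simp
  moreover have "N > 0"
  proof -
    obtain i where i: "i < n" "v $ i \<noteq> 0" using v(1,2) by (auto simp: vec_eq_iff)
    have "0 < (cmod (v $ i))\<^sup>2" using i by simp
    also have "\<dots> \<le> N" unfolding N_def using i by (intro member_le_sum) auto
    finally show ?thesis .
  qed
  ultimately show ?thesis unfolding q1 by simp
qed

text \<open>Over the complex numbers the polynomial splits, and its roots are eigenvalues, hence
  real. Injectivity of the embedding of real polynomials brings the factorization back.\<close>

lemma symmetric_char_poly_splits: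
  assumes A: "(A :: real mat) \<in> carrier_mat n n"
    and sym: "\<And>i j. i < n \<Longrightarrow> j < n \<Longrightarrow> A $$ (i, j) = A $$ (j, i)"
  shows "\<exists>es. char_poly A = (\<Prod>e\<leftarrow>es. [:- e, 1:]) \<and> length es = n"
proof -
  interpret P: map_poly_inj_idom_hom complex_of_real ..
  let ?M = "map_mat complex_of_real A"
  have M: "?M \<in> carrier_mat n n" using A by simp
  obtain as where as: "char_poly ?M = (\<Prod>a\<leftarrow>as. [:- a, 1:])" "length as = n"
    using char_poly_factorized[OF M] by blast
  have im: "Im a = 0" if "a \<in> set as" for a
  proof (rule symmetric_eigenvalue_real[OF A sym])
    have "poly (char_poly ?M) a = 0"
      unfolding as using that by (auto simp: poly_prod_list prod_list_zero_iff)
    then show "eigenvalue ?M a" using eigenvalue_root_char_poly[OF M] by blast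
  qed auto
  have as_eq: "as = map complex_of_real (map Re as)"
    by (simp add: comp_def, rule map_idI[symmetric], insert im, simp add: complex_eq_iff)
  have "map_poly complex_of_real (char_poly A) = char_poly ?M"
    by (rule of_real_hom.char_poly_hom[OF A, symmetric])
  also have "\<dots> = (\<Prod>a\<leftarrow>map complex_of_real (map Re as). [:- a, 1:])"
    unfolding as_eq[symmetric] by (rule as(1))
  also have "\<dots> = map_poly complex_of_real (\<Prod>e\<leftarrow>map Re as. [:- e, 1:])"
  proof -
    have lin: "map_poly complex_of_real [:- e, 1:] = [:- complex_of_real e, 1:]" for e
      by (simp add: map_poly_pCons)
    have "map_poly complex_of_real (\<Prod>e\<leftarrow>rs. [:- e, 1:])
        = (\<Prod>a\<leftarrow>map complex_of_real rs. [:- a, 1:])" for rs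
      by (induction rs) (simp_all only: list.map prod_list.Nil prod_list.Cons P.hom_mult P.hom_one lin)
    from this[of "map Re as"] show ?thesis by (rule HOL.sym)
  qed
  finally have "char_poly A = (\<Prod>e\<leftarrow>map Re as. [:- e, 1:])"
    unfolding P.eq_iff .
  then show ?thesis using as(2) by (intro exI[of _ "map Re as"]) simp
qed

section \<open>Contraction on functions of mean zero\<close>

definition mat_op :: "nat \<Rightarrow> real mat \<Rightarrow> (nat \<Rightarrow> real) \<Rightarrow> nat \<Rightarrow> real" where
  "mat_op n A f i = (\<Sum>j<n. A $$ (i, j) * f j)"

definition sqnorm :: "nat \<Rightarrow> (nat \<Rightarrow> real) \<Rightarrow> real" where
  "sqnorm n f = (\<Sum>i<n. (f i)\<^sup>2)"

lemma sqnorm_nonneg [simp]: "sqnorm n f \<ge> 0"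
  by (simp add: sqnorm_def sum_nonneg)

lemma abs_le_sqrt_sqnorm: "i < n \<Longrightarrow> \<bar>f i\<bar> \<le> sqrt (sqnorm n f)"
  unfolding sqnorm_def
  by (rule real_le_rsqrt) (auto intro!: member_le_sum)

lemma Cauchy_Schwarz_sum:
  fixes f g :: "'a \<Rightarrow> real"
  shows "(\<Sum>i\<in>I. f i * g i)\<^sup>2 \<le> (\<Sum>i\<in>I. (f i)\<^sup>2) * (\<Sum>i\<in>I. (g i)\<^sup>2)"
proof -
  have "\<bar>\<Sum>i\<in>I. f i * g i\<bar> \<le> L2_set f I * L2_set g I"
    by (rule order.trans[OF sum_abs]) (simp add: abs_mult L2_set_mult_ineq)
  then have "\<bar>\<Sum>i\<in>I. f i * g i\<bar>\<^sup>2 \<le> (L2_set f I * L2_set g I)\<^sup>2"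
    by (intro power_mono) auto
  then show ?thesis by (simp add: L2_set_def power_mult_distrib sum_nonneg)
qed

section \<open>Symmetric stochastic matrices as self-adjoint averaging operators\<close>

locale symmetric_stochastic =
  fixes n :: nat and A :: "real mat"
  assumes carrier [simp]: "A \<in> carrier_mat n n"
    and symm: "i < n \<Longrightarrow> j < n \<Longrightarrow> A $$ (i, j) = A $$ (j, i)"
    and row_sum: "i < n \<Longrightarrow> (\<Sum>j<n. A $$ (i, j)) = 1"
    and nonneg: "i < n \<Longrightarrow> j < n \<Longrightarrow> A $$ (i, j) \<ge> 0"
    and two_le_n: "n \<ge> 2"
begin

abbreviation "op \<equiv> mat_op n A"

lemma pow_carrier [simp]: "A ^\<^sub>m k \<in> carrier_mat n n"
  by simp

lemma pow_Suc_entry: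
  "i < n \<Longrightarrow> j < n \<Longrightarrow> (A ^\<^sub>m Suc k) $$ (i, j) = (\<Sum>l<n. (A ^\<^sub>m k) $$ (i, l) * A $$ (l, j))"
  using mat_mult_entry[OF pow_carrier carrier] by simp

lemma pow_op: "i < n \<Longrightarrow> (op ^^ k) f i = (\<Sum>j<n. (A ^\<^sub>m k) $$ (i, j) * f j)"
proof (induction k arbitrary: f)
  case 0
  have "(\<Sum>j<n. (1\<^sub>m n) $$ (i, j) * f j) = (\<Sum>j<n. if j = i then f j else 0)"
    using 0 by (intro sum.cong) auto
  then show ?case using 0 carrier_matD[OF carrier] by simp
next
  case (Suc k)
  have "(op ^^ Suc k) f i = (\<Sum>l<n. (A ^\<^sub>m k) $$ (i, l) * op f l)"
    using Suc by (simp add: funpow_Suc_right del: funpow.simps)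
  also have "\<dots> = (\<Sum>l<n. \<Sum>j<n. (A ^\<^sub>m k) $$ (i, l) * A $$ (l, j) * f j)"
    by (simp add: mat_op_def sum_distrib_left mult.assoc)
  also have "\<dots> = (\<Sum>j<n. \<Sum>l<n. (A ^\<^sub>m k) $$ (i, l) * A $$ (l, j) * f j)"
    by (rule sum.swap)
  also have "\<dots> = (\<Sum>j<n. (A ^\<^sub>m Suc k) $$ (i, j) * f j)"
    using Suc.prems by (intro sum.cong refl) (simp add: pow_Suc_entry sum_distrib_right del: pow_mat.simps)
  finally show ?case .
qed

lemma op_self_adjoint: "(\<Sum>i<n. f i * op g i) = (\<Sum>i<n. op f i * g i)"
proof -
  have "(\<Sum>i<n. f i * op g i) = (\<Sum>i<n. \<Sum>j<n. f i * (A $$ (i, j) * g j))"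
    by (simp add: mat_op_def sum_distrib_left)
  also have "\<dots> = (\<Sum>j<n. \<Sum>i<n. f i * (A $$ (i, j) * g j))"
    by (rule sum.swap)
  also have "\<dots> = (\<Sum>j<n. op f j * g j)"
    unfolding mat_op_def sum_distrib_right by (intro sum.cong refl) (simp add: symm)
  finally show ?thesis .
qed

lemma sum_op: "(\<Sum>i<n. op f i) = (\<Sum>i<n. f i)"
proof -
  have "(\<Sum>i<n. op f i) = (\<Sum>i<n. op (\<lambda>_. 1) i * f i)"
    using op_self_adjoint[of "\<lambda>_. 1" f] by simp
  also have "\<dots> = (\<Sum>i<n. f i)"
    by (intro sum.cong) (auto simp: mat_op_def row_sum)
  finally show ?thesis .
qed

lemma sum_pow_op: "(\<Sum>i<n. (op ^^ k) f i) = (\<Sum>i<n. f i)"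
  by (induction k) (simp_all add: sum_op)

lemma op_const: "i < n \<Longrightarrow> op (\<lambda>_. c) i = c"
  by (simp add: mat_op_def row_sum flip: sum_distrib_right)

lemma op_cong: "(\<And>j. j < n \<Longrightarrow> f j = g j) \<Longrightarrow> op f i = op g i"
  unfolding mat_op_def by (intro sum.cong) auto

lemma op_mono: "(\<And>j. j < n \<Longrightarrow> f j \<le> g j) \<Longrightarrow> i < n \<Longrightarrow> op f i \<le> op g i"
  unfolding mat_op_def by (intro sum_mono mult_left_mono) (auto simp: nonneg)

lemma op_add_const: "i < n \<Longrightarrow> op (\<lambda>j. c + f j) i = c + op f i"
  by (simp add: mat_op_def distrib_left sum.distrib row_sum flip: sum_distrib_right)

lemma pow_row_sum: "i < n \<Longrightarrow> (\<Sum>j<n. (A ^\<^sub>m k) $$ (i, j)) = 1"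
proof -
  assume i: "i < n"
  have "(op ^^ k) (\<lambda>_. 1) i = 1" using i
  proof (induction k arbitrary: i)
    case (Suc k)
    then have "op ((op ^^ k) (\<lambda>_. 1)) i = op (\<lambda>_. 1) i" by (intro op_cong) auto
    then show ?case using Suc by (simp add: op_const)
  qed simp
  then show ?thesis using pow_op[OF i, of k "\<lambda>_. 1"] by simp
qed

text \<open>Self-adjointness passes to the iterates of \<open>op\<close>; testing it on two point
  masses reads off the entries of the power.\<close>

lemma pow_symm: "i < n \<Longrightarrow> j < n \<Longrightarrow> (A ^\<^sub>m k) $$ (i, j) = (A ^\<^sub>m k) $$ (j, i)"
proof -
  assume ij: "i < n" "j < n"
  have delta: "(\<Sum>l<n. h l * (if l = b then 1 else 0)) = h b"
    "(\<Sum>l<n. (if l = b then 1 else 0) * h l) = h b" if "b < n" for h :: "nat \<Rightarrow> real" and b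
  proof -
    have "(\<Sum>l<n. h l * (if l = b then 1 else 0)) = (\<Sum>l<n. if l = b then h l else 0)"
      by (intro sum.cong) auto
    then show "(\<Sum>l<n. h l * (if l = b then 1 else 0)) = h b" using that by simp
    then show "(\<Sum>l<n. (if l = b then 1 else 0) * h l) = h b" by (simp only: mult.commute)
  qed
  have entry: "(op ^^ k) (\<lambda>l. if l = b then 1 else 0) a = (A ^\<^sub>m k) $$ (a, b)"
    if "a < n" "b < n" for a b
    using that by (simp only: pow_op delta)
  have adj: "(\<Sum>i<n. f i * (op ^^ k) g i) = (\<Sum>i<n. (op ^^ k) f i * g i)" for f g
  proof (induction k arbitrary: g)
    case (Suc k)
    have "(op ^^ Suc k) g = (op ^^ k) (op g)" by (simp only: funpow_Suc_right o_apply)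
    moreover have "(op ^^ Suc k) f = op ((op ^^ k) f)" by simp
    ultimately show ?case
      using Suc[of "op g"] op_self_adjoint[of "(op ^^ k) f" g] by metis
  qed simp
  show ?thesis
    using adj[of "\<lambda>l. if l = i then 1 else 0" "\<lambda>l. if l = j then 1 else 0"] ij
    by (simp only: delta entry)
qed

lemma pow_add: "A ^\<^sub>m (k + l) = A ^\<^sub>m k * A ^\<^sub>m l"
  by (induction l) (use carrier_matD[OF carrier] in \<open>simp_all add: assoc_mult_mat[of _ n n _ n _ n, symmetric]\<close>)

lemma trace_even_pow: "mat_trace (A ^\<^sub>m (k + k)) = (\<Sum>i<n. \<Sum>j<n. ((A ^\<^sub>m k) $$ (i, j))\<^sup>2)"
proof -
  have "mat_trace (A ^\<^sub>m (k + k)) = (\<Sum>i<n. \<Sum>j<n. (A ^\<^sub>m k) $$ (i, j) * (A ^\<^sub>m k) $$ (j, i))"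
    unfolding pow_add mat_trace_def using carrier_matD[OF carrier]
    by (auto simp: mat_mult_entry[OF pow_carrier pow_carrier] simp del: index_mult_mat(1) intro!: sum.cong)
  also have "\<dots> = (\<Sum>i<n. \<Sum>j<n. ((A ^\<^sub>m k) $$ (i, j))\<^sup>2)"
    by (intro sum.cong refl) (simp add: power2_eq_square pow_symm)
  finally show ?thesis .
qed

text \<open>The formula of \<open>spec_lambda\<close> for a general matrix, so that the expander
  hypothesis carries over by unfolding.\<close>

definition nontrivial_radius :: real where
  "nontrivial_radius = Max ((\<lambda>x. \<bar>x\<bar>) ` set_mset (proots (char_poly A) - {#1#}))"

text \<open>The all-ones vector shows that 1 is a root. Removing one copy leaves
  \<open>n - 1\<close> roots, a nonempty multiset as \<open>n \<ge> 2\<close>, so \<open>Max\<close>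
  is a genuine maximum and bounds each of them.\<close>

lemma
  shows nontrivial_radius_nonneg: "nontrivial_radius \<ge> 0"
    and trace_bound: "mat_trace (A ^\<^sub>m (k + k)) \<le> 1 + real (n - 1) * (nontrivial_radius ^ k)\<^sup>2"
proof -
  obtain es where es: "char_poly A = (\<Prod>e\<leftarrow>es. [:- e, 1:])" "length es = n"
    using symmetric_char_poly_splits[OF carrier symm] by blast
  have roots: "proots (char_poly A) = mset es"
  proof -
    have "0 \<notin> (\<lambda>e. [:- e, 1:]) ` set es" by auto
    then show ?thesis
      using proots_prod_list[of "map (\<lambda>e. [:- e, 1:]) es"] unfolding es(1) by (simp add: comp_def)
  qed
  have "eigenvalue A 1"
    unfolding eigenvalue_def eigenvector_def
  proof (intro exI conjI)
    let ?u = "vec n (\<lambda>_. 1) :: real vec"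
    show "?u \<in> carrier_vec (dim_row A)" using carrier_matD[OF carrier] by simp
    have "?u $ 0 \<noteq> 0\<^sub>v n $ 0" using two_le_n by simp
    then show "?u \<noteq> 0\<^sub>v (dim_row A)" using carrier_matD[OF carrier] by auto
    show "A *\<^sub>v ?u = 1 \<cdot>\<^sub>v ?u"
      using carrier_matD[OF carrier] row_sum
      by (intro eq_vecI) (auto simp: scalar_prod_def atLeast0LessThan)
  qed
  then have "poly (char_poly A) 1 = 0" using eigenvalue_root_char_poly[OF carrier] by blast
  then have one: "1 \<in># mset es" unfolding es by (auto simp: poly_prod_list prod_list_zero_iff)
  define M where "M = mset es - {#1#}"
  have M: "mset es = add_mset 1 M" using one by (simp add: M_def)
  have size_M: "size M = n - 1" using es(2) M by (metis size_add_mset size_mset diff_Suc_1)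
  have r: "nontrivial_radius = Max ((\<lambda>x. \<bar>x\<bar>) ` set_mset M)"
    by (simp add: nontrivial_radius_def roots M_def)
  have le: "\<bar>x\<bar> \<le> nontrivial_radius" if "x \<in># M" for x
    unfolding r using that by (intro Max_ge) auto
  have "M \<noteq> {#}" using size_M two_le_n by auto
  then obtain x where "x \<in># M" by blast
  from le[OF this] show nn: "nontrivial_radius \<ge> 0" by linarith
  have "mat_trace (A ^\<^sub>m (k + k)) = (\<Sum>e\<in>#mset es. e ^ (k + k))"
    using mat_trace_pow[OF carrier es(1), of "k + k"] by (simp flip: mset_map sum_mset_sum_list)
  also have "\<dots> = 1 + (\<Sum>e\<in>#M. e ^ (k + k))" by (simp add: M)
  also have "(\<Sum>e\<in>#M. e ^ (k + k)) \<le> (\<Sum>e\<in>#M. (nontrivial_radius ^ k)\<^sup>2)"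
  proof (rule sum_mset_mono)
    fix e assume "e \<in># M"
    have "e ^ (k + k) = \<bar>e\<bar> ^ (k + k)" by (simp add: power_even_abs)
    also have "\<dots> \<le> nontrivial_radius ^ (k + k)" by (intro power_mono le \<open>e \<in># M\<close>) simp
    finally show "e ^ (k + k) \<le> (nontrivial_radius ^ k)\<^sup>2" by (simp add: power_add power2_eq_square)
  qed
  also have "\<dots> = real (n - 1) * (nontrivial_radius ^ k)\<^sup>2" by (simp add: size_M)
  finally show "mat_trace (A ^\<^sub>m (k + k)) \<le> 1 + real (n - 1) * (nontrivial_radius ^ k)\<^sup>2" by simp
qed

text \<open>On mean-zero functions \<open>A ^\<^sub>m k\<close> acts like \<open>B\<close>, which is
  \<open>A ^\<^sub>m k\<close> minus the matrix with all entries \<open>1 / n\<close>. The squared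
  Frobenius norm of \<open>B\<close> is the trace of \<open>A ^\<^sub>m (k + k)\<close> minus 1, so
  the trivial eigenvalue cancels.\<close>

lemma sqnorm_pow_op_le:
  assumes g: "(\<Sum>i<n. g i) = 0"
  shows "sqnorm n ((op ^^ k) g) \<le> real (n - 1) * (nontrivial_radius ^ k)\<^sup>2 * sqnorm n g"
proof -
  define B where "B i j = (A ^\<^sub>m k) $$ (i, j) - 1 / real n" for i j
  have n0: "real n > 0" using two_le_n by simp
  have "((op ^^ k) g i)\<^sup>2 \<le> (\<Sum>j<n. (B i j)\<^sup>2) * sqnorm n g" if "i < n" for i
  proof -
    have "(op ^^ k) g i = (\<Sum>j<n. B i j * g j)"
      using that g by (simp add: pow_op B_def left_diff_distrib sum_subtractf flip: sum_divide_distrib)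
    then show ?thesis using Cauchy_Schwarz_sum[of "B i" g "{..<n}"] by (simp add: sqnorm_def)
  qed
  then have "sqnorm n ((op ^^ k) g) \<le> (\<Sum>i<n. (\<Sum>j<n. (B i j)\<^sup>2) * sqnorm n g)"
    unfolding sqnorm_def[of n "(op ^^ k) g"] by (intro sum_mono) auto
  also have "\<dots> = (\<Sum>i<n. \<Sum>j<n. (B i j)\<^sup>2) * sqnorm n g"
    by (simp add: sum_distrib_right)
  also have "(\<Sum>i<n. \<Sum>j<n. (B i j)\<^sup>2) = mat_trace (A ^\<^sub>m (k + k)) - 1"
  proof -
    have "(\<Sum>j<n. (B i j)\<^sup>2) = (\<Sum>j<n. ((A ^\<^sub>m k) $$ (i, j))\<^sup>2) - 1 / real n" if "i < n" for i
    proof -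
      have "(\<Sum>j<n. (B i j)\<^sup>2) = (\<Sum>j<n. ((A ^\<^sub>m k) $$ (i, j))\<^sup>2 - 2 / real n * (A ^\<^sub>m k) $$ (i, j) + (1 / real n)\<^sup>2)"
        unfolding B_def by (intro sum.cong refl) (simp add: power2_diff)
      also have "\<dots> = (\<Sum>j<n. ((A ^\<^sub>m k) $$ (i, j))\<^sup>2) - 2 / real n * (\<Sum>j<n. (A ^\<^sub>m k) $$ (i, j)) + n * (1 / real n)\<^sup>2"
        by (simp add: sum.distrib sum_subtractf sum_distrib_left)
      finally show ?thesis using n0 that by (simp add: pow_row_sum power2_eq_square field_simps)
    qed
    then have "(\<Sum>i<n. \<Sum>j<n. (B i j)\<^sup>2) = (\<Sum>i<n. (\<Sum>j<n. ((A ^\<^sub>m k) $$ (i, j))\<^sup>2) - 1 / real n)"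
      by (intro sum.cong) auto
    then show ?thesis using n0 by (simp add: trace_even_pow sum_subtractf)
  qed
  also have "(mat_trace (A ^\<^sub>m (k + k)) - 1) * sqnorm n g \<le> (real (n - 1) * (nontrivial_radius ^ k)\<^sup>2) * sqnorm n g"
    using trace_bound[of k] by (intro mult_right_mono) auto
  finally show ?thesis .
qed

text \<open>Moving one \<open>op\<close> across the inner product turns the squared norm of
  \<open>op g\<close> into the product of \<open>g\<close> with \<open>op (op g)\<close>, to which
  Cauchy-Schwarz applies.\<close>

lemma sqnorm_op_log_convex: "(sqnorm n (op g))\<^sup>2 \<le> sqnorm n g * sqnorm n (op (op g))"
proof -
  have "sqnorm n (op g) = (\<Sum>i<n. g i * op (op g) i)"
    using op_self_adjoint[of g "op g"] by (simp add: sqnorm_def power2_eq_square)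
  then show ?thesis using Cauchy_Schwarz_sum[of g "op (op g)" "{..<n}"] by (simp add: sqnorm_def)
qed

text \<open>The trace only gives the bound up to a factor $n$; log-convexity of the norm of $A^k g$ in $k$
  removes that factor, since an excess in the first step would persist geometrically.\<close>

lemma sqnorm_op_le:
  assumes g: "(\<Sum>i<n. g i) = 0"
  shows "sqnorm n (op g) \<le> nontrivial_radius\<^sup>2 * sqnorm n g"
proof (rule ccontr)
  let ?r = "nontrivial_radius\<^sup>2"
  define a where "a k = sqnorm n ((op ^^ k) g)" for k
  assume "\<not> ?thesis"
  then have a1: "a 1 > ?r * a 0" by (simp add: a_def)
  have a_le: "a k \<le> real (n - 1) * ?r ^ k * a 0" for k
    using sqnorm_pow_op_le[OF g, of k] by (simp add: a_def flip: power_mult) (simp add: mult.commute)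
  have nn: "a k \<ge> 0" for k by (simp add: a_def)
  have a0: "a 0 > 0"
  proof (rule ccontr)
    assume "\<not> a 0 > 0"
    then have "a 0 = 0" using nn[of 0] by simp
    then show False using a_le[of 1] a1 by simp
  qed
  \<comment> \<open>The first growth ratio. Log-convexity makes every later ratio at least
    \<open>q\<close>, while the trace bound caps the growth at \<open>?r ^ k\<close> up to the
    factor \<open>n\<close>.\<close>
  define q where "q = a 1 / a 0"
  have q: "q > ?r" using a1 a0 by (simp add: q_def field_simps)
  then have q0: "q > 0" by (meson le_less_trans zero_le_power2)
  have conv: "(a (Suc k))\<^sup>2 \<le> a k * a (Suc (Suc k))" for k
    using sqnorm_op_log_convex[of "(op ^^ k) g"] by (simp add: a_def)
  have grow: "a k > 0 \<and> a (Suc k) \<ge> q * a k" for k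
  proof (induction k)
    case 0
    then show ?case using a0 by (simp add: q_def)
  next
    case (Suc k)
    have pos: "a (Suc k) > 0" using Suc q0 by (meson less_le_trans mult_pos_pos)
    have "(q * a k) * a (Suc k) \<le> a (Suc k) * a (Suc k)"
      using Suc pos by (intro mult_right_mono) auto
    then have "a k * (q * a (Suc k)) \<le> a (Suc k) * a (Suc k)"
      by (simp only: mult_ac)
    also have "\<dots> \<le> a k * a (Suc (Suc k))" using conv[of k] by (simp add: power2_eq_square)
    finally have "q * a (Suc k) \<le> a (Suc (Suc k))" using Suc by simp
    then show ?case using pos by simp
  qed
  have ge: "a k \<ge> q ^ k * a 0" for k
  proof (induction k)
    case (Suc k)
    have "q ^ Suc k * a 0 \<le> q * a k" using Suc q0 by (simp add: mult.assoc mult_left_mono)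
    then show ?case using grow[of k] by simp
  qed simp
  have bound: "q ^ k \<le> real n * ?r ^ k" for k
  proof -
    have "q ^ k * a 0 \<le> real (n - 1) * ?r ^ k * a 0" using ge[of k] a_le[of k] by linarith
    then have "q ^ k \<le> real (n - 1) * ?r ^ k" using a0 by simp
    also have "\<dots> \<le> real n * ?r ^ k" by (intro mult_right_mono) auto
    finally show ?thesis .
  qed
  have r0: "?r > 0"
  proof (rule ccontr)
    assume "\<not> ?r > 0"
    then have "?r = 0" by (metis less_eq_real_def zero_le_power2)
    then show False using bound[of 1] q0 by simp
  qed
  have "q / ?r > 1" using q r0 by (simp add: field_simps)
  then obtain k where "(q / ?r) ^ k > real n" using real_arch_pow by blast
  then show False using bound[of k] r0 by (simp add: power_divide field_simps)
qed

end

section \<open>Hitting times\<close>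

locale spectral_gap = symmetric_stochastic +
  fixes lam :: real
  assumes radius_less: "nontrivial_radius < lam" and lam_less_1: "lam < 1"
begin

lemma lam_pos: "lam > 0"
  using nontrivial_radius_nonneg radius_less by linarith

lemma sqnorm_op_contract:
  assumes "(\<Sum>i<n. g i) = 0"
  shows "sqnorm n (op g) \<le> lam\<^sup>2 * sqnorm n g"
proof -
  have "nontrivial_radius\<^sup>2 * sqnorm n g \<le> lam\<^sup>2 * sqnorm n g"
    using nontrivial_radius_nonneg radius_less by (intro mult_right_mono power_mono) auto
  then show ?thesis using sqnorm_op_le[OF assms] by linarith
qed

lemma sqnorm_pow_op_contract:
  assumes "(\<Sum>i<n. g i) = 0"
  shows "sqnorm n ((op ^^ k) g) \<le> (lam ^ k)\<^sup>2 * sqnorm n g"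
proof (induction k)
  case (Suc k)
  have "(\<Sum>i<n. (op ^^ k) g i) = 0" using assms sum_pow_op by simp
  then have "sqnorm n ((op ^^ Suc k) g) \<le> lam\<^sup>2 * sqnorm n ((op ^^ k) g)"
    using sqnorm_op_contract by simp
  also have "\<dots> \<le> lam\<^sup>2 * ((lam ^ k)\<^sup>2 * sqnorm n g)"
    using Suc by (intro mult_left_mono) auto
  finally show ?case by (simp add: power_mult_distrib)
qed simp

definition mean :: "(nat \<Rightarrow> real) \<Rightarrow> real" where
  "mean f = (\<Sum>i<n. f i) / real n"

lemma sum_minus_mean: "(\<Sum>i<n. f i - mean f) = 0"
  using two_le_n by (simp add: mean_def sum_subtractf)

lemma sqnorm_minus_mean: "sqnorm n (\<lambda>i. f i - mean f) = sqnorm n f - real n * (mean f)\<^sup>2"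
proof -
  have "sqnorm n (\<lambda>i. f i - mean f) = (\<Sum>i<n. (f i)\<^sup>2 - 2 * mean f * f i + (mean f)\<^sup>2)"
    unfolding sqnorm_def by (intro sum.cong refl) (simp add: power2_diff)
  also have "\<dots> = sqnorm n f - 2 * mean f * (\<Sum>i<n. f i) + real n * (mean f)\<^sup>2"
    by (simp add: sum.distrib sum_subtractf sqnorm_def sum_distrib_left)
  also have "(\<Sum>i<n. f i) = real n * mean f" using two_le_n by (simp add: mean_def)
  finally show ?thesis by (simp add: power2_eq_square)
qed

lemma pow_op_decompose: "i < n \<Longrightarrow> (op ^^ k) f i = mean f + (op ^^ k) (\<lambda>j. f j - mean f) i"
  by (simp add: pow_op right_diff_distrib sum_subtractf pow_row_sum flip: sum_distrib_right)

text \<open>Split \<open>f\<close> into its mean and a mean-zero part: the cross terms vanish, the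
  mean is fixed by \<open>op\<close>, and Cauchy-Schwarz with the contraction handles the
  rest.\<close>

lemma inner_op_le:
  "(\<Sum>i<n. f i * op f i) \<le> lam * sqnorm n f + (1 - lam) * (real n * (mean f)\<^sup>2)"
proof -
  define g where "g = (\<lambda>i. f i - mean f)"
  have g0: "(\<Sum>i<n. g i) = 0" unfolding g_def by (rule sum_minus_mean)
  have op_g0: "(\<Sum>i<n. op g i) = 0" using g0 sum_op by simp
  have "(\<Sum>i<n. f i * op f i) = (\<Sum>i<n. (mean f + g i) * (mean f + op g i))"
    using pow_op_decompose[of _ 1 f] by (intro sum.cong refl) (simp add: g_def)
  also have "\<dots> = real n * (mean f)\<^sup>2 + mean f * (\<Sum>i<n. op g i) + mean f * (\<Sum>i<n. g i) + (\<Sum>i<n. g i * op g i)"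
    by (simp add: algebra_simps sum.distrib sum_distrib_left power2_eq_square)
  also have "\<dots> = real n * (mean f)\<^sup>2 + (\<Sum>i<n. g i * op g i)" using g0 op_g0 by simp
  also have "(\<Sum>i<n. g i * op g i) \<le> lam * sqnorm n g"
  proof (rule power2_le_imp_le)
    have "(\<Sum>i<n. g i * op g i)\<^sup>2 \<le> sqnorm n g * sqnorm n (op g)"
      unfolding sqnorm_def by (rule Cauchy_Schwarz_sum)
    also have "\<dots> \<le> sqnorm n g * (lam\<^sup>2 * sqnorm n g)"
      using sqnorm_op_contract[OF g0] by (intro mult_left_mono) auto
    finally show "(\<Sum>i<n. g i * op g i)\<^sup>2 \<le> (lam * sqnorm n g)\<^sup>2" by (simp add: power2_eq_square mult_ac)
  qed (use lam_pos in simp)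
  also have "sqnorm n g = sqnorm n f - real n * (mean f)\<^sup>2"
    unfolding g_def by (rule sqnorm_minus_mean)
  finally show ?thesis by (simp add: algebra_simps)
qed

text \<open>\<^term>\<open>hit S T v\<close> is the expectation of the minimum of $T$ and the hitting time of $S$ from $v$.
  Truncating makes everything finite, and \<^term>\<open>hit S T \<le> hit S (Suc T)\<close> turns the recursion
  into the inequality that the untruncated expectation would satisfy.\<close>

primrec hit :: "nat set \<Rightarrow> nat \<Rightarrow> nat \<Rightarrow> real" where
  "hit S 0 = (\<lambda>_. 0)"
| "hit S (Suc T) = (\<lambda>i. if i \<in> S then 0 else 1 + op (hit S T) i)"

lemma hit_mem: "i \<in> S \<Longrightarrow> hit S T i = 0"
  by (cases T) auto

lemma op_nonneg: "(\<And>j. j < n \<Longrightarrow> f j \<ge> 0) \<Longrightarrow> i < n \<Longrightarrow> op f i \<ge> 0"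
  by (auto simp: mat_op_def nonneg intro!: sum_nonneg)

lemma hit_nonneg: "i < n \<Longrightarrow> hit S T i \<ge> 0"
  by (induction T arbitrary: i) (auto intro!: add_nonneg_nonneg op_nonneg)

lemma hit_mono: "i < n \<Longrightarrow> hit S T i \<le> hit S (Suc T) i"
proof (induction T arbitrary: i)
  case 0
  then show ?case using hit_nonneg[of i S "Suc 0"] by simp
next
  case (Suc T)
  have "op (hit S T) i \<le> op (hit S (Suc T)) i" using Suc by (intro op_mono) auto
  then show ?case by simp
qed

lemma hit_le_Suc_op: "i < n \<Longrightarrow> i \<notin> S \<Longrightarrow> hit S T i \<le> 1 + op (hit S T) i"
  using hit_mono[of i S T] by simp

text \<open>Running the walk for \<open>k\<close> steps before looking for \<open>S\<close> costs at
  most \<open>k\<close>, even from inside \<open>S\<close>, where \<open>hit\<close> vanishes. This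
  leaves room for the walk to mix first.\<close>

lemma hit_le_pow_op: "i < n \<Longrightarrow> hit S T i \<le> real k + (op ^^ k) (hit S T) i"
proof (induction k arbitrary: i)
  case (Suc k)
  have "hit S T i \<le> 1 + op (hit S T) i"
  proof (cases "i \<in> S")
    case True
    then show ?thesis using op_nonneg[of "hit S T" i] hit_nonneg Suc.prems by (simp add: hit_mem)
  qed (use hit_le_Suc_op Suc.prems in auto)
  also have "op (hit S T) i \<le> op (\<lambda>j. real k + (op ^^ k) (hit S T) j) i"
    using Suc by (intro op_mono) auto
  also have "\<dots> = real k + (op ^^ Suc k) (hit S T) i"
    using Suc.prems by (simp add: op_add_const)
  finally show ?case by simp
qed simp

text \<open>Restricted to functions vanishing on $S$, the operator has norm at most
  $1 - (1 - \lambda) |S| / n$, because such a function is far from constant.\<close>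

lemma sqnorm_hit_le:
  assumes S: "S \<subseteq> {..<n}" "S \<noteq> {}"
  shows "sqrt (sqnorm n (hit S T)) \<le> sqrt (real n) * (real n / ((1 - lam) * real (card S)))"
proof -
  let ?f = "hit S T"
  define N where "N = sqnorm n ?f"
  define s where "s = real (card S)"
  have fin: "finite S" using S finite_subset by auto
  have s0: "s > 0" using S fin by (simp add: s_def card_gt_0_iff)
  have n0: "real n > 0" using two_le_n by simp
  have l: "1 - lam > 0" using lam_less_1 by simp
  have m: "real n * mean ?f = (\<Sum>i<n. ?f i)" using n0 by (simp add: mean_def)
  \<comment> \<open>\<open>?f\<close> vanishes on \<open>S\<close>, so Cauchy-Schwarz is applied
    against the constant 1 on the complement only. The gain from \<open>n\<close> to
    \<open>n - s\<close> is what produces the rate.\<close>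
  have CS: "(\<Sum>i<n. ?f i)\<^sup>2 \<le> (real n - s) * N"
  proof -
    have "(\<Sum>i<n. ?f i) = (\<Sum>i\<in>{..<n}-S. 1 * ?f i)"
      by (auto intro!: sum.mono_neutral_right simp: hit_mem)
    moreover have "N = (\<Sum>i\<in>{..<n}-S. (?f i)\<^sup>2)"
      unfolding N_def sqnorm_def by (auto intro!: sum.mono_neutral_right simp: hit_mem)
    moreover have "(\<Sum>i\<in>{..<n}-S. 1\<^sup>2) = real n - s"
    proof -
      have "card ({..<n} - S) = n - card S" using S fin by (subst card_Diff_subset) auto
      moreover have "card S \<le> n" using card_mono[OF _ S(1)] by simp
      ultimately show ?thesis by (simp add: s_def)
    qed
    ultimately show ?thesis using Cauchy_Schwarz_sum[of "\<lambda>_. 1" ?f "{..<n} - S"] by simp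
  qed
  \<comment> \<open>The recursion inequality for \<open>hit\<close>, multiplied by
    \<open>?f i\<close> and summed; on \<open>S\<close> both sides are zero.\<close>
  have "N \<le> (\<Sum>i<n. ?f i + ?f i * op ?f i)"
    unfolding N_def sqnorm_def
  proof (rule sum_mono)
    fix i assume "i \<in> {..<n}"
    then have i: "i < n" by simp
    show "(?f i)\<^sup>2 \<le> ?f i + ?f i * op ?f i"
    proof (cases "i \<in> S")
      case False
      have "?f i * ?f i \<le> ?f i * (1 + op ?f i)"
        using hit_le_Suc_op[OF i False] hit_nonneg[OF i] by (intro mult_left_mono) auto
      then show ?thesis by (simp add: power2_eq_square algebra_simps)
    qed (simp add: hit_mem)
  qed
  also have "\<dots> \<le> (\<Sum>i<n. ?f i) + (lam * N + (1 - lam) * (real n * (mean ?f)\<^sup>2))"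
    using inner_op_le[of ?f] by (simp add: sum.distrib N_def)
  also have "real n * (mean ?f)\<^sup>2 = (\<Sum>i<n. ?f i)\<^sup>2 / real n"
    using n0 by (simp add: m[symmetric] power2_eq_square)
  also have "(1 - lam) * ((\<Sum>i<n. ?f i)\<^sup>2 / real n) \<le> (1 - lam) * ((real n - s) * N / real n)"
    using CS l n0 by (intro mult_left_mono divide_right_mono) auto
  finally have "N \<le> (\<Sum>i<n. ?f i) + (lam * N + (1 - lam) * ((real n - s) * N / real n))"
    by simp
  moreover have "(1 - lam) * ((real n - s) * N / real n) = (1 - lam) * N - (1 - lam) * (s / real n) * N"
    using n0 by (simp add: field_simps)
  ultimately have main: "(1 - lam) * (s / real n) * N \<le> (\<Sum>i<n. ?f i)"
    by (simp add: algebra_simps)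
  have "(\<Sum>i<n. ?f i) \<le> sqrt (real n * N)"
  proof (rule real_le_rsqrt)
    have "(real n - s) * N \<le> real n * N" using s0 by (intro mult_right_mono) (auto simp: N_def)
    then show "(\<Sum>i<n. ?f i)\<^sup>2 \<le> real n * N" using CS by linarith
  qed
  with main have "((1 - lam) * (s / real n) * sqrt N) * sqrt N \<le> sqrt (real n) * sqrt N"
    by (simp add: real_sqrt_mult mult.assoc N_def)
  moreover have ?thesis if "sqrt N = 0"
    using that n0 l by (simp add: N_def)
  ultimately have "(1 - lam) * (s / real n) * sqrt N \<le> sqrt (real n)" if "sqrt N \<noteq> 0"
    using that by (metis N_def mult_le_cancel_right less_eq_real_def not_le sqnorm_nonneg real_sqrt_ge_zero)
  then show ?thesis
    using \<open>sqrt N = 0 \<Longrightarrow> ?thesis\<close> n0 l s0 by (cases "sqrt N = 0") (auto simp: N_def s_def field_simps)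
qed

lemma hit_le:
  assumes S: "S \<subseteq> {..<n}" "S \<noteq> {}" and v: "v < n"
  shows "hit S T v \<le> (3 * ln (real n) + 2 * real n / real (card S)) / (1 - lam)"
proof -
  let ?f = "hit S T"
  \<comment> \<open>A mixing time: since \<open>lam \<le> exp (lam - 1)\<close>, this many steps
    give \<open>lam ^ k \<le> 1 / n\<close>.\<close>
  define k where "k = nat \<lceil>ln (real n) / (1 - lam)\<rceil>"
  define B where "B = real n / ((1 - lam) * real (card S))"
  have n0: "real n > 0" using two_le_n by simp
  have l: "1 - lam > 0" using lam_less_1 by simp
  have B0: "B \<ge> 0" using l by (simp add: B_def)
  have ln_half: "ln (real n) \<ge> 1 / 2"
  proof -
    have "ln 2 \<le> ln (real n)" using two_le_n by simp
    then show ?thesis using ln2_ge_two_thirds by linarith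
  qed
  have k_ge: "real k \<ge> ln (real n) / (1 - lam)" unfolding k_def by linarith
  have k_le: "real k \<le> ln (real n) / (1 - lam) + 1"
    unfolding k_def using ln_half l by (simp add: of_nat_nat)
  have sq: "sqrt (sqnorm n ?f) \<le> sqrt (real n) * B"
    unfolding B_def by (rule sqnorm_hit_le[OF S])
  have lam_k: "lam ^ k * real n \<le> 1"
  proof -
    have "lam \<le> exp (lam - 1)" using exp_ge_add_one_self[of "lam - 1"] by simp
    then have "lam ^ k \<le> exp (lam - 1) ^ k" using lam_pos by (intro power_mono) auto
    also have "\<dots> = exp (real k * (lam - 1))" by (rule exp_of_nat_mult[symmetric])
    also have "\<dots> \<le> exp (- ln (real n))"
      using k_ge l by (simp add: field_simps)
    also have "\<dots> = 1 / real n" using n0 by (simp add: exp_minus inverse_eq_divide)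
    finally show ?thesis using n0 by (simp add: field_simps)
  qed
  have mean_le: "mean ?f \<le> B"
  proof -
    have "real n * (mean ?f)\<^sup>2 \<le> sqnorm n ?f"
      using sqnorm_minus_mean[of ?f] sqnorm_nonneg[of n "\<lambda>i. ?f i - mean ?f"] by linarith
    also have "\<dots> \<le> (sqrt (real n) * B)\<^sup>2"
      using sq by (simp add: sqrt_le_D)
    also have "\<dots> = real n * B\<^sup>2" using n0 by (simp add: power_mult_distrib)
    finally have "(mean ?f)\<^sup>2 \<le> B\<^sup>2" using n0 by simp
    then show ?thesis using B0 by (rule power2_le_imp_le)
  qed
  \<comment> \<open>A value is at most the norm, and the norm of \<open>?f\<close> is at most
    \<open>sqrt n * B\<close>. Enlarging \<open>sqrt n\<close> to \<open>n\<close> lets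
    \<open>lam_k\<close> cancel it.\<close>
  have fluct: "(op ^^ k) (\<lambda>j. ?f j - mean ?f) v \<le> B"
  proof -
    have "(op ^^ k) (\<lambda>j. ?f j - mean ?f) v \<le> sqrt (sqnorm n ((op ^^ k) (\<lambda>j. ?f j - mean ?f)))"
      using abs_le_sqrt_sqnorm[OF v] by (meson abs_le_D1)
    also have "\<dots> \<le> sqrt ((lam ^ k)\<^sup>2 * sqnorm n (\<lambda>j. ?f j - mean ?f))"
      by (intro real_sqrt_le_mono sqnorm_pow_op_contract sum_minus_mean)
    also have "\<dots> = lam ^ k * sqrt (sqnorm n (\<lambda>j. ?f j - mean ?f))"
      using lam_pos by (simp add: real_sqrt_mult)
    also have "\<dots> \<le> lam ^ k * sqrt (sqnorm n ?f)"
      using lam_pos n0 by (intro mult_left_mono real_sqrt_le_mono) (auto simp: sqnorm_minus_mean)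
    also have "\<dots> \<le> lam ^ k * (sqrt (real n) * B)"
      using lam_pos sq by (intro mult_left_mono) auto
    also have "\<dots> \<le> lam ^ k * (real n * B)"
      using lam_pos B0 n0 two_le_n
      by (intro mult_left_mono mult_right_mono) (auto intro!: real_le_lsqrt simp: power2_eq_square)
    also have "\<dots> \<le> 1 * B" using lam_k B0 by (simp only: mult.assoc[symmetric] mult_right_mono)
    finally show ?thesis by simp
  qed
  have "?f v \<le> real k + (op ^^ k) ?f v" by (rule hit_le_pow_op[OF v])
  also have "\<dots> \<le> real k + 2 * B"
    using pow_op_decompose[OF v, of k ?f] mean_le fluct by simp
  \<comment> \<open>One \<open>ln n / (1 - lam)\<close> comes from \<open>k\<close> itself; two more
    absorb the 1 lost in rounding up, because \<open>ln n \<ge> 1 / 2\<close> and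
    \<open>1 - lam < 1\<close>.\<close>
  also have "\<dots> \<le> 3 * ln (real n) / (1 - lam) + 2 * B"
  proof -
    have "1 \<le> 2 * ln (real n) / (1 - lam)"
      using ln_half l lam_pos by (simp add: field_simps)
    then show ?thesis using k_le by (simp add: add_divide_distrib)
  qed
  also have "\<dots> = (3 * ln (real n) + 2 * real n / real (card S)) / (1 - lam)"
    by (simp add: B_def add_divide_distrib mult.commute)
  finally show ?thesis .
qed

end

section \<open>Even subgraphs and cycles\<close>

definition degree_in :: "nat set set \<Rightarrow> nat \<Rightarrow> nat" where
  "degree_in F v = card {e\<in>F. v \<in> e}"

definition touched :: "nat set set \<Rightarrow> nat set" where
  "touched F = {v. \<exists>e\<in>F. v \<in> e}"

lemma simple_graph_subset: "simple_graph n E \<Longrightarrow> F \<subseteq> E \<Longrightarrow> simple_graph n F"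
  by (auto simp: simple_graph_def)

lemma simple_graph_finite: "simple_graph n E \<Longrightarrow> finite E"
  by (rule finite_subset[of _ "Pow {..<n}"]) (auto simp: simple_graph_def)

lemma simple_graph_edgeD:
  "simple_graph n E \<Longrightarrow> {u, v} \<in> E \<Longrightarrow> u \<noteq> v \<and> u < n \<and> v < n"
  unfolding simple_graph_def by (metis doubleton_eq_iff)

lemma simple_graph_incidentE:
  assumes "simple_graph n E" "e \<in> E" "v \<in> e"
  obtains w where "e = {v, w}"
  using assms unfolding simple_graph_def by (metis insert_commute insert_iff singletonD)

lemma touched_less: "simple_graph n E \<Longrightarrow> F \<subseteq> E \<Longrightarrow> touched F \<subseteq> {..<n}"
  by (fastforce simp: touched_def simple_graph_def)

lemma degree_in_insert:
  "finite F \<Longrightarrow> e \<notin> F \<Longrightarrow> degree_in (insert e F) v = degree_in F v + (if v \<in> e then 1 else 0)"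
proof -
  assume "finite F" "e \<notin> F"
  moreover have "{x \<in> insert e F. v \<in> x} = (if v \<in> e then insert e {x\<in>F. v \<in> x} else {x\<in>F. v \<in> x})" by auto
  ultimately show ?thesis by (simp add: degree_in_def)
qed

lemma degree_in_eq_0_iff: "finite F \<Longrightarrow> degree_in F v = 0 \<longleftrightarrow> v \<notin> touched F"
  by (auto simp: degree_in_def touched_def)

lemma handshake:
  assumes "simple_graph n F"
  shows "(\<Sum>v<n. degree_in F v) = 2 * card F"
proof -
  have fin: "finite F" using assms by (rule simple_graph_finite)
  have "(\<Sum>v<n. degree_in F v) = (\<Sum>v<n. \<Sum>e\<in>F. if v \<in> e then 1 else 0)"
    using fin by (simp add: degree_in_def sum.If_cases Int_def)
  also have "\<dots> = (\<Sum>e\<in>F. \<Sum>v<n. if v \<in> e then 1 else 0)"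
    by (rule sum.swap)
  also have "\<dots> = (\<Sum>e\<in>F. 2)"
  proof (rule sum.cong)
    fix e assume "e \<in> F"
    then obtain u v where e: "e = {u, v}" "u \<noteq> v" "u < n" "v < n"
      using assms by (auto simp: simple_graph_def)
    then have "{..<n} \<inter> {x. x \<in> e} = {u, v}" by auto
    then show "(\<Sum>v<n. if v \<in> e then 1 else 0) = (2::nat)"
      using e by (simp add: sum.If_cases)
  qed simp
  finally show ?thesis by simp
qed

text \<open>The handshake sum runs only over touched vertices, each of degree at most
  \<open>d\<close>. This bounds the target set of a random phase from below.\<close>

lemma card_edges_le_touched:
  assumes E: "simple_graph n E" "regular n E d" and F: "F \<subseteq> E"
  shows "2 * card F \<le> d * card (touched F)"
proof -
  have fin: "finite E" "finite F" using E F simple_graph_finite finite_subset by blast+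
  note less = touched_less[OF E(1) F]
  have "2 * card F = (\<Sum>v<n. degree_in F v)"
    using handshake[OF simple_graph_subset[OF E(1) F]] by simp
  also have "\<dots> = (\<Sum>v\<in>touched F. degree_in F v)"
    using less by (intro sum.mono_neutral_right) (auto simp: degree_in_eq_0_iff fin)
  also have "\<dots> \<le> (\<Sum>v\<in>touched F. d)"
  proof (rule sum_mono)
    fix v assume "v \<in> touched F"
    then have "card {e\<in>E. v \<in> e} = d" using less E(2) by (auto simp: regular_def)
    moreover have "degree_in F v \<le> card {e\<in>E. v \<in> e}"
      unfolding degree_in_def using F fin by (intro card_mono) auto
    ultimately show "degree_in F v \<le> d" by simp
  qed
  finally show ?thesis by (simp add: mult.commute)
qed

lemma cycle_length_le_card:
  assumes "finite F" "is_cycle F c"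
  shows "length c \<le> card F"
proof -
  let ?k = "length c"
  let ?e = "\<lambda>i. {c ! i, c ! ((i + 1) mod ?k)}"
  have k: "?k \<ge> 3" and dist: "distinct c" and F: "\<forall>i<?k. ?e i \<in> F"
    using assms by (auto simp: is_cycle_def)
  have "inj_on ?e {..<?k}"
  proof (rule inj_onI)
    fix i j assume ij: "i \<in> {..<?k}" "j \<in> {..<?k}" and eq: "?e i = ?e j"
    have nth: "c ! a = c ! b \<longleftrightarrow> a = b" if "a < ?k" "b < ?k" for a b
      using dist that by (simp add: nth_eq_iff_index_eq)
    have "?k > 0" using k by linarith
    then have less: "(i + 1) mod ?k < ?k" "(j + 1) mod ?k < ?k" by (rule mod_less_divisor)+
    \<comment> \<open>Two different positions with the same edge would be successors of each other
      modulo the length, which is impossible for length at least 3.\<close>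
    have "i = j \<or> (i = (j + 1) mod ?k \<and> (i + 1) mod ?k = j)"
      using eq ij less by (auto simp: doubleton_eq_iff nth)
    then show "i = j"
      using ij k by (auto simp: mod_Suc split: if_splits)
  qed
  moreover have "?e ` {..<?k} \<subseteq> F" using F by auto
  ultimately show ?thesis using card_inj_on_le[OF _ _ assms(1)] by fastforce
qed

text \<open>The first vertex of a longest path has a second edge. Its other end lies on the path by
  maximality, and closing up there gives a cycle.\<close>

lemma ex_cycle_if_no_leaf:
  assumes F: "simple_graph n F" "F \<noteq> {}" and leaf: "\<And>v. degree_in F v \<noteq> 1"
  shows "\<exists>c. is_cycle F c"
proof -
  define path where
    "path p \<longleftrightarrow> length p \<ge> 2 \<and> distinct p \<and> (\<forall>i. Suc i < length p \<longrightarrow> {p ! i, p ! Suc i} \<in> F)" for p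
  obtain u v where uv: "{u, v} \<in> F" "u \<noteq> v"
    using F unfolding simple_graph_def by (metis ex_in_conv)
  have "path [u, v]" using uv by (auto simp: path_def)
  moreover have "length p < Suc n" if "path p" for p
  proof -
    have "p ! i < n" if "i < length p" for i
    proof (cases i)
      case 0
      then have "{p ! 0, p ! Suc 0} \<in> F" using \<open>path p\<close> by (auto simp: path_def)
      then show ?thesis using simple_graph_edgeD[OF F(1)] 0 by blast
    next
      case (Suc j)
      then have "{p ! j, p ! Suc j} \<in> F" using \<open>path p\<close> that by (auto simp: path_def)
      then show ?thesis using simple_graph_edgeD[OF F(1)] Suc by blast
    qed
    then have "set p \<subseteq> {..<n}" by (auto simp: in_set_conv_nth)
    then have "card (set p) \<le> n" using card_mono[of "{..<n}" "set p"] by simp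
    moreover have "card (set p) = length p" using that distinct_card by (auto simp: path_def)
    ultimately show ?thesis by simp
  qed
  ultimately obtain p where p: "path p" and longest: "\<And>q. path q \<Longrightarrow> length q \<le> length p"
    using ex_has_greatest_nat[of path "[u, v]" length "Suc n"] by blast
  define x where "x = p ! 0"
  have len: "length p \<ge> 2" and dist: "distinct p" and step: "\<And>i. Suc i < length p \<Longrightarrow> {p ! i, p ! Suc i} \<in> F"
    using p by (auto simp: path_def)
  have first: "{x, p ! 1} \<in> F" using step[of 0] len by (simp add: x_def)
  have "\<exists>e\<in>F. x \<in> e \<and> e \<noteq> {x, p ! 1}"
  proof (rule ccontr)
    assume "\<not> ?thesis"
    then have "\<forall>e\<in>F. x \<in> e \<longrightarrow> e = {x, p ! 1}" by blast
    moreover have "x \<in> {x, p ! 1}" by simp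
    ultimately have "{e\<in>F. x \<in> e} = {{x, p ! 1}}" using first by blast
    then show False using leaf[of x] by (simp add: degree_in_def)
  qed
  then obtain e where e: "e \<in> F" "x \<in> e" "e \<noteq> {x, p ! 1}" by blast
  obtain z where "e = {x, z}" using simple_graph_incidentE[OF F(1) e(1,2)] .
  with e have z: "{x, z} \<in> F" "z \<noteq> p ! 1" by auto
  have "z \<noteq> x" using simple_graph_edgeD[OF F(1) z(1)] by auto
  have "z \<in> set p"
  proof (rule ccontr)
    assume "z \<notin> set p"
    have "path (z # p)"
      unfolding path_def
    proof (intro conjI allI impI)
      fix i assume "Suc i < length (z # p)"
      then show "{(z # p) ! i, (z # p) ! Suc i} \<in> F"
        using z(1) step by (cases i) (auto simp: x_def insert_commute)
    qed (use \<open>z \<notin> set p\<close> dist len in auto)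
    then show False using longest[of "z # p"] by simp
  qed
  then obtain j where j: "j < length p" "p ! j = z" by (auto simp: in_set_conv_nth)
  have "j \<noteq> 0" using j \<open>z \<noteq> x\<close> x_def by metis
  moreover have "j \<noteq> 1" using j z(2) by metis
  ultimately have j2: "j \<ge> 2" by simp
  have "is_cycle F (take (Suc j) p)"
    unfolding is_cycle_def
  proof (intro conjI allI impI)
    fix i assume "i < length (take (Suc j) p)"
    then have i: "i \<le> j" using j by simp
    have l: "length (take (Suc j) p) = Suc j" using j by simp
    show "{take (Suc j) p ! i, take (Suc j) p ! ((i + 1) mod length (take (Suc j) p))} \<in> F"
    proof (cases "i = j")
      case True
      then show ?thesis using z(1) j unfolding l by (simp add: x_def insert_commute)
    next
      case False
      then show ?thesis using step[of i] i j unfolding l by simp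
    qed
  qed (use j j2 dist in auto)
  then show ?thesis by blast
qed

lemma girth_le: "is_cycle E c \<Longrightarrow> girth E \<le> length c"
  unfolding girth_def by (intro Least_le) auto

text \<open>The given cycle is what makes the \<open>LEAST\<close> in \<open>girth\<close>
  attained.\<close>

lemma girth_ge_3: "is_cycle E c \<Longrightarrow> girth E \<ge> 3"
proof -
  assume "is_cycle E c"
  then have "\<exists>k c. is_cycle E c \<and> length c = k" by blast
  from LeastI_ex[OF this] have "\<exists>c. is_cycle E c \<and> length c = girth E"
    unfolding girth_def .
  then show ?thesis by (auto simp: is_cycle_def)
qed

lemma girth_even_subgraph:
  assumes E: "simple_graph n E" and F: "F \<subseteq> E" "F \<noteq> {}" and even: "\<And>v. even (degree_in F v)"
  shows "girth E \<le> card F" "girth E \<ge> 3"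
proof -
  have "degree_in F v \<noteq> 1" for v using even[of v] by auto
  then obtain c where c: "is_cycle F c"
    using ex_cycle_if_no_leaf[OF simple_graph_subset[OF E F(1)] F(2)] by blast
  have cE: "is_cycle E c" using c F unfolding is_cycle_def by blast
  have "finite F" using E F simple_graph_finite finite_subset by blast
  then show "girth E \<le> card F" using girth_le[OF cE] cycle_length_le_card[OF _ c] by linarith
  show "girth E \<ge> 3" using girth_ge_3[OF cE] .
qed

section \<open>The normalized adjacency matrix as one uniform step of the walk\<close>

lemma card_neighbors:
  assumes "simple_graph n E" "regular n E d" "v < n"
  shows "card (neighbors E v) = d"
proof -
  have "bij_betw (\<lambda>w. {v, w}) (neighbors E v) {e\<in>E. v \<in> e}"
    unfolding bij_betw_def
  proof
    show "inj_on (\<lambda>w. {v, w}) (neighbors E v)" by (auto simp: inj_on_def doubleton_eq_iff)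
    show "(\<lambda>w. {v, w}) ` neighbors E v = {e\<in>E. v \<in> e}"
    proof (intro equalityI subsetI)
      fix e assume "e \<in> {e\<in>E. v \<in> e}"
      then have e: "e \<in> E" "v \<in> e" by auto
      obtain w where "e = {v, w}" using simple_graph_incidentE[OF assms(1) e] .
      then show "e \<in> (\<lambda>w. {v, w}) ` neighbors E v" using e by (auto simp: neighbors_def)
    qed (auto simp: neighbors_def)
  qed
  from bij_betw_same_card[OF this] show ?thesis using assms by (simp add: regular_def)
qed

lemma neighbors_less: "simple_graph n E \<Longrightarrow> neighbors E v \<subseteq> {..<n}"
  using simple_graph_edgeD by (fastforce simp: neighbors_def)

lemma mat_op_norm_adj:
  assumes "simple_graph n E" "v < n"
  shows "mat_op n (norm_adj n E d) f v = (\<Sum>w\<in>neighbors E v. f w) / real d"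
proof -
  have "mat_op n (norm_adj n E d) f v = (\<Sum>w<n. if w \<in> neighbors E v then f w / real d else 0)"
    using assms unfolding mat_op_def by (intro sum.cong) (auto simp: norm_adj_def neighbors_def)
  also have "\<dots> = (\<Sum>w\<in>{..<n} \<inter> neighbors E v. f w / real d)"
    by (simp add: sum.If_cases)
  also have "{..<n} \<inter> neighbors E v = neighbors E v"
    using neighbors_less[OF assms(1)] by auto
  finally show ?thesis by (simp add: sum_divide_distrib)
qed

lemma expander_spectral_gap:
  assumes "expander n E d lam" "n \<ge> 2" "d > 0"
  shows "spectral_gap n (norm_adj n E d) lam"
proof -
  have E: "simple_graph n E" "regular n E d" using assms by (auto simp: expander_def)
  interpret symmetric_stochastic n "norm_adj n E d"
  proof
    fix i assume i: "i < n"
    have "mat_op n (norm_adj n E d) (\<lambda>_. 1) i = 1"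
      using mat_op_norm_adj[OF E(1) i] card_neighbors[OF E i] assms(3) by simp
    then show "(\<Sum>j<n. norm_adj n E d $$ (i, j)) = 1" by (simp add: mat_op_def)
  next
    fix i j assume "i < n" "j < n"
    then show "norm_adj n E d $$ (i, j) = norm_adj n E d $$ (j, i)"
      by (simp add: norm_adj_def insert_commute[of i j])
  qed (use assms(2) in \<open>simp_all add: norm_adj_def\<close>)
  show ?thesis
    using assms by unfold_locales (auto simp: expander_def spec_lambda_def adj_eigenvalues_def nontrivial_radius_def)
qed

section \<open>The greedy random walk\<close>

lemma traversed_snoc:
  assumes "h \<noteq> []"
  shows "traversed (h @ [w]) = insert {last h, w} (traversed h)"
proof -
  have image: "traversed p = (\<lambda>s. {p ! (s - 1), p ! s}) ` {0<..<length p}" for p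
    by (auto simp: traversed_def)
  have "{0<..<length (h @ [w])} = insert (length h) {0<..<length h}" using assms by auto
  then have "traversed (h @ [w]) = insert {last h, w} ((\<lambda>s. {(h @ [w]) ! (s - 1), (h @ [w]) ! s}) ` {0<..<length h})"
    using assms by (simp add: image nth_append last_conv_nth)
  also have "(\<lambda>s. {(h @ [w]) ! (s - 1), (h @ [w]) ! s}) ` {0<..<length h} = traversed h"
    unfolding image by (intro image_cong) (auto simp: nth_append)
  finally show ?thesis .
qed

lemma traversed_singleton: "traversed [v] = {}"
  by (auto simp: traversed_def)

lemma length_grw: "h \<in> set_pmf (grw E R v0 t) \<Longrightarrow> length h = Suc t"
  by (induction t arbitrary: h) auto

text \<open>\<^term>\<open>uncovered_time E R T h\<close> is the expected number of the next $T$ times, the present one included,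
  at which the walk continued from the history $h$ has not traversed all edges.\<close>

primrec uncovered_time :: "nat set set \<Rightarrow> (nat list \<Rightarrow> nat pmf) \<Rightarrow> nat \<Rightarrow> nat list \<Rightarrow> ennreal" where
  "uncovered_time E R 0 h = 0"
| "uncovered_time E R (Suc T) h =
     indicator {h. traversed h \<noteq> E} h + (\<integral>\<^sup>+ w. uncovered_time E R T (h @ [w]) \<partial>measure_pmf (grw_step E R h))"

text \<open>\<open>grw\<close> extends histories at the end, while \<open>uncovered_time\<close>
  recurses on the next step. The induction peels off the earliest time, hence the arbitrary start
  \<open>s\<close>.\<close>

lemma sum_uncovered:
  "(\<Sum>t<T. ennreal (measure_pmf.prob (grw E R v0 (s + t)) {h. traversed h \<noteq> E}))
     = (\<integral>\<^sup>+ h. uncovered_time E R T h \<partial>measure_pmf (grw E R v0 s))"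
proof (induction T arbitrary: s)
  case 0
  have "uncovered_time E R 0 = (\<lambda>_. 0)" by auto
  then show ?case by simp
next
  case (Suc T)
  have "(\<Sum>t<Suc T. ennreal (measure_pmf.prob (grw E R v0 (s + t)) {h. traversed h \<noteq> E}))
      = emeasure (measure_pmf (grw E R v0 s)) {h. traversed h \<noteq> E}
        + (\<integral>\<^sup>+ h. uncovered_time E R T h \<partial>measure_pmf (grw E R v0 (Suc s)))"
    unfolding sum.lessThan_Suc_shift using Suc[of "Suc s"]
    by (simp add: measure_pmf.emeasure_eq_measure del: grw.simps)
  also have "\<dots> = (\<integral>\<^sup>+ h. uncovered_time E R (Suc T) h \<partial>measure_pmf (grw E R v0 s))"
    by (simp add: nn_integral_add nn_integral_bind_pmf nn_integral_map_pmf)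
  finally show ?case .
qed

text \<open>A history at time \<open>t\<close> has length \<open>t + 1\<close>, so the prefix for
  \<open>s = t\<close> is the whole history and not being covered by \<open>t\<close> implies an
  untraversed edge now. A bound uniform in the horizon passes to the supremum of the partial
  sums.\<close>

lemma expected_edge_cover_time_le:
  assumes "\<And>T. uncovered_time E R T [v0] \<le> B"
  shows "expected_edge_cover_time E R v0 \<le> B"
proof -
  have "measure_pmf.prob (grw E R v0 t) {h. not_covered_by E t h}
      \<le> measure_pmf.prob (grw E R v0 t) {h. traversed h \<noteq> E}" for t
  proof (rule measure_pmf.finite_measure_mono_AE)
    show "AE h in measure_pmf (grw E R v0 t). h \<in> {h. not_covered_by E t h} \<longrightarrow> h \<in> {h. traversed h \<noteq> E}"
    proof (subst AE_measure_pmf_iff, intro ballI impI)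
      fix h assume "h \<in> set_pmf (grw E R v0 t)" "h \<in> {h. not_covered_by E t h}"
      then show "h \<in> {h. traversed h \<noteq> E}"
        using length_grw[of h E R v0 t] unfolding not_covered_by_def by auto
    qed
  qed simp
  then have "expected_edge_cover_time E R v0
      \<le> (\<Sum>t. ennreal (measure_pmf.prob (grw E R v0 t) {h. traversed h \<noteq> E}))"
    unfolding expected_edge_cover_time_def by (intro suminf_le) (auto intro: ennreal_leI)
  also have "\<dots> \<le> B"
    unfolding suminf_eq_SUP
  proof (rule SUP_least)
    fix T
    show "(\<Sum>t<T. ennreal (measure_pmf.prob (grw E R v0 t) {h. traversed h \<noteq> E})) \<le> B"
      using sum_uncovered[of E R v0 0 T] assms[of T] by simp
  qed
  finally show ?thesis .
qed

lemma nn_integral_pmf_le: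
  "(\<And>x. x \<in> set_pmf p \<Longrightarrow> f x \<le> c) \<Longrightarrow> (\<integral>\<^sup>+ x. f x \<partial>measure_pmf p) \<le> c"
proof -
  assume "\<And>x. x \<in> set_pmf p \<Longrightarrow> f x \<le> c"
  then have "(\<integral>\<^sup>+ x. f x \<partial>measure_pmf p) \<le> (\<integral>\<^sup>+ x. c \<partial>measure_pmf p)"
    by (intro nn_integral_mono_AE) (simp add: AE_measure_pmf_iff)
  then show ?thesis by simp
qed

text \<open>The step is \<open>ln x \<le> x - 1\<close> at \<open>x = k / (k + 1)\<close>.\<close>

lemma sum_inverse_le: "M \<ge> 1 \<Longrightarrow> (\<Sum>j=1..M. 1 / real j) \<le> 1 + ln (real M)"
proof (induction M rule: dec_induct)
  case (step k)
  have "ln (real k / real (Suc k)) \<le> real k / real (Suc k) - 1"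
    using step by (intro ln_le_minus_one) auto
  also have "\<dots> = - (1 / real (Suc k))" by (simp add: field_simps)
  finally have "1 / real (Suc k) \<le> ln (real (Suc k)) - ln (real k)"
    using step by (simp add: ln_div)
  then show ?case using step by simp
qed simp

section \<open>Cost accounting for a fixed graph and rule\<close>

locale greedy_walk =
  fixes n d :: nat and lam :: real and E :: "nat set set" and R :: "nat list \<Rightarrow> nat pmf"
  assumes is_expander: "expander n E d lam" and two_le_n: "n \<ge> 2" and d_pos: "d > 0" and even_d: "even d"
    and rule: "admissible_rule E R"
begin

sublocale gap: spectral_gap n "norm_adj n E d" lam
  using is_expander two_le_n d_pos by (rule expander_spectral_gap)

abbreviation "g \<equiv> girth E"

lemma E: "simple_graph n E" "regular n E d"
  using is_expander by (auto simp: expander_def)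

lemma fin_E [simp]: "finite E"
  using E(1) by (rule simple_graph_finite)

lemma degree_in_E: "degree_in E v = (if v < n then d else 0)"
proof (cases "v < n")
  case False
  then have "v \<notin> touched E" using touched_less[OF E(1) order.refl] by auto
  then show ?thesis using False by (simp add: degree_in_eq_0_iff)
qed (use E(2) in \<open>simp add: regular_def degree_in_def\<close>)

lemma two_card_E: "2 * card E = n * d"
  using handshake[OF E(1)] by (simp add: degree_in_E)

lemma E_nonempty: "E \<noteq> {}"
  using two_card_E two_le_n d_pos by auto

lemma girth_bounds: "g \<ge> 3" "g \<le> card E"
  using girth_even_subgraph[OF E(1) order.refl E_nonempty] even_d by (simp_all add: degree_in_E)

abbreviation remaining :: "nat list \<Rightarrow> nat set set" where
  "remaining h \<equiv> E - traversed h"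

text \<open>The invariant quantifies over all such histories, whether or not the rule can produce
  them.\<close>

definition walk :: "nat list \<Rightarrow> bool" where
  "walk h \<longleftrightarrow> h \<noteq> [] \<and> last h < n \<and> traversed h \<subseteq> E"

lemma walk_snoc: "walk h \<Longrightarrow> {last h, w} \<in> E \<Longrightarrow> walk (h @ [w])"
  using simple_graph_edgeD[OF E(1)] by (auto simp: walk_def traversed_snoc)

lemma unused_empty_iff: "unused E h = {} \<longleftrightarrow> last h \<notin> touched (remaining h)"
  by (auto simp: unused_def touched_def)

definition relocation_cost :: "nat \<Rightarrow> real" where
  "relocation_cost j = (3 * ln (real n) + 2 * real (card E) / real (g * j)) / (1 - lam)"

text \<open>Each greedy phase is a closed trail and hence removes at least $g$ edges, so with $u$ edges
  left there are at most \<^term>\<open>u div g\<close> further random phases.\<close>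

definition total_cost :: "nat \<Rightarrow> real" where
  "total_cost m = (\<Sum>j=1..m. relocation_cost j)"

lemma relocation_cost_nonneg: "relocation_cost j \<ge> 0"
  using gap.lam_less_1 two_le_n unfolding relocation_cost_def
  by (intro divide_nonneg_nonneg add_nonneg_nonneg) auto

lemma total_cost_mono: "a \<le> b \<Longrightarrow> total_cost a \<le> total_cost b"
  unfolding total_cost_def by (intro sum_mono2) (auto simp: relocation_cost_nonneg)

lemma total_cost_nonneg: "total_cost a \<ge> 0"
  unfolding total_cost_def by (intro sum_nonneg) (auto simp: relocation_cost_nonneg)

text \<open>With \<open>s\<close> the number of touched vertices and
  \<open>m = card U div g\<close>, the replacement rests on \<open>g * m \<le> card U\<close>,
  \<open>2 * card U \<le> d * s\<close> and \<open>n * d = 2 * card E\<close>, which give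
  \<open>n * (g * m) \<le> card E * s\<close>.\<close>

lemma hit_le_relocation_cost:
  assumes U: "U \<subseteq> E" "U \<noteq> {}" "g \<le> card U" and v: "v < n"
  shows "gap.hit (touched U) T v \<le> relocation_cost (card U div g)"
proof -
  define s where "s = card (touched U)"
  have fin: "finite U" using U(1) by (rule finite_subset) simp
  have less: "touched U \<subseteq> {..<n}" using touched_less[OF E(1) U(1)] .
  have "card U > 0" using U fin by (simp add: card_gt_0_iff)
  have s: "2 * card U \<le> d * s" unfolding s_def by (rule card_edges_le_touched[OF E U(1)])
  with \<open>card U > 0\<close> have s0: "s > 0" by (cases s) auto
  then have ne: "touched U \<noteq> {}" by (auto simp: s_def)
  define m where "m = card U div g"
  have m0: "g * m > 0" using U(3) girth_bounds by (simp add: m_def div_greater_zero_iff)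
  have gm: "g * m \<le> card U" by (simp add: m_def)
  have "n * (g * m) \<le> card E * s"
  proof -
    have "2 * (n * (g * m)) \<le> n * (2 * card U)" using gm by simp
    also have "\<dots> \<le> n * (d * s)" using s by simp
    also have "\<dots> = 2 * (card E * s)" using two_card_E by simp
    finally show ?thesis by simp
  qed
  then have "real n * real (g * m) \<le> real (card E) * real s"
    by (metis of_nat_le_iff of_nat_mult)
  then have "real n / real s \<le> real (card E) / real (g * m)"
    using s0 m0 by (simp add: divide_simps mult.commute)
  then have "(3 * ln (real n) + 2 * real n / real s) / (1 - lam) \<le> relocation_cost m"
    using gap.lam_less_1 unfolding relocation_cost_def by (intro divide_right_mono) auto
  then show ?thesis using gap.hit_le[OF less ne v, of T] by (simp add: s_def m_def)
qed

lemma covered_uncovered_time: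
  "walk h \<Longrightarrow> remaining h = {} \<Longrightarrow> uncovered_time E R T h = 0"
proof (induction T arbitrary: h)
  case (Suc T)
  have tr: "traversed h = E" using Suc.prems by (auto simp: walk_def)
  have "unused E h = {}" by (auto simp: unused_def tr)
  have last: "last h < n" using Suc.prems by (simp add: walk_def)
  \<comment> \<open>A nonempty finite set of neighbors is what gives \<open>pmf_of_set\<close> its
    intended support.\<close>
  have N: "neighbors E (last h) \<noteq> {}" "finite (neighbors E (last h))"
    using card_neighbors[OF E last] d_pos by (auto intro: card_ge_0_finite)
  have "(\<integral>\<^sup>+ w. uncovered_time E R T (h @ [w]) \<partial>measure_pmf (grw_step E R h)) \<le> 0"
  proof (rule nn_integral_pmf_le)
    fix w assume "w \<in> set_pmf (grw_step E R h)"
    then have w: "{last h, w} \<in> E"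
      using N \<open>unused E h = {}\<close> by (simp add: grw_step_def neighbors_def)
    then have "remaining (h @ [w]) = {}"
      using Suc.prems tr by (auto simp: walk_def traversed_snoc)
    then show "uncovered_time E R T (h @ [w]) \<le> 0"
      using Suc.IH[OF walk_snoc[OF Suc.prems(1) w]] by simp
  qed
  then show ?case by (simp add: tr)
qed simp

definition stuck_bound :: "nat \<Rightarrow> bool" where
  "stuck_bound T \<longleftrightarrow> (\<forall>h. walk h \<longrightarrow> remaining h \<noteq> {} \<longrightarrow> unused E h = {} \<longrightarrow>
     (\<forall>v. even (degree_in (remaining h) v)) \<longrightarrow>
     uncovered_time E R T h \<le> ennreal (real (card (remaining h))
       + gap.hit (touched (remaining h)) T (last h) + total_cost (card (remaining h) div g - 1)))"

text \<open>Here $v$ is the vertex where the current greedy phase started and $P$ the set of edges used since.\<close>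

definition greedy_bound :: "nat \<Rightarrow> bool" where
  "greedy_bound T \<longleftrightarrow> (\<forall>h v P. walk h \<longrightarrow> P \<subseteq> traversed h \<longrightarrow>
     (\<forall>x. odd (degree_in P x) \<longleftrightarrow> (x = v) \<noteq> (x = last h)) \<longrightarrow>
     (\<forall>x. odd (degree_in (remaining h) x) \<longleftrightarrow> (x = v) \<noteq> (x = last h)) \<longrightarrow>
     P \<noteq> {} \<or> unused E h \<noteq> {} \<longrightarrow>
     uncovered_time E R T h \<le> ennreal (real (card (remaining h))
       + total_cost ((card (remaining h) + card P) div g - 1)))"

lemma greedy_boundD:
  assumes "greedy_bound T" "walk h" "P \<subseteq> traversed h"
    "\<And>x. odd (degree_in P x) \<longleftrightarrow> (x = v) \<noteq> (x = last h)"
    "\<And>x. odd (degree_in (remaining h) x) \<longleftrightarrow> (x = v) \<noteq> (x = last h)"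
    "P \<noteq> {} \<or> unused E h \<noteq> {}"
  shows "uncovered_time E R T h \<le> ennreal (real (card (remaining h))
    + total_cost ((card (remaining h) + card P) div g - 1))"
  using assms(1)[unfolded greedy_bound_def, rule_format, OF assms(2-6)] .

lemma stuck_bound_Suc:
  assumes stuck: "stuck_bound T" and greedy: "greedy_bound T"
  shows "stuck_bound (Suc T)"
  unfolding stuck_bound_def
proof (intro allI impI)
  fix h assume h: "walk h" and ne: "remaining h \<noteq> {}" and un: "unused E h = {}"
    and even: "\<forall>v. even (degree_in (remaining h) v)"
  let ?U = "remaining h" and ?X = "last h"
  let ?S = "touched ?U"
  define a where "a = real (card ?U) + total_cost (card ?U div g - 1)"
  have a0: "a \<ge> 0" by (simp add: a_def total_cost_nonneg)
  have X: "?X < n" using h by (simp add: walk_def)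
  have XS: "?X \<notin> ?S" using un by (simp add: unused_empty_iff)
  have card_N: "card (neighbors E ?X) = d" using card_neighbors[OF E X] .
  have N: "neighbors E ?X \<noteq> {}" "finite (neighbors E ?X)"
    using card_N d_pos by (auto intro: card_ge_0_finite)
  have less: "w < n" if "w \<in> neighbors E ?X" for w
    using that neighbors_less[OF E(1)] by auto
  have step: "uncovered_time E R T (h @ [w]) \<le> ennreal (a + gap.hit ?S T w)"
    if w: "w \<in> neighbors E ?X" for w
  proof -
    have wE: "{?X, w} \<in> E" using w by (simp add: neighbors_def)
    then have "{?X, w} \<in> traversed h" using un by (auto simp: unused_def)
    then have tr: "traversed (h @ [w]) = traversed h"
      using h by (auto simp: walk_def traversed_snoc)
    have walk': "walk (h @ [w])" using walk_snoc[OF h wE] .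
    show ?thesis
    proof (cases "w \<in> ?S")
      \<comment> \<open>The target is reached: a greedy phase starts at \<open>w\<close> with no
        edges of its own, and \<open>gap.hit\<close> is zero there.\<close>
      case True
      then have "unused E (h @ [w]) \<noteq> {}" by (auto simp: unused_empty_iff tr)
      then have "uncovered_time E R T (h @ [w]) \<le> ennreal (real (card (remaining (h @ [w])))
          + total_cost ((card (remaining (h @ [w])) + card ({} :: nat set set)) div g - 1))"
        using even by (intro greedy_boundD[OF greedy walk', where v = w]) (simp_all add: tr degree_in_def)
      then show ?thesis using True by (simp add: tr a_def gap.hit_mem)
    next
      case False
      then have "unused E (h @ [w]) = {}" by (simp add: unused_empty_iff tr)
      moreover have "remaining (h @ [w]) \<noteq> {}" "\<forall>v. even (degree_in (remaining (h @ [w])) v)"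
        using ne even by (simp_all add: tr)
      ultimately have "uncovered_time E R T (h @ [w]) \<le> ennreal (real (card (remaining (h @ [w])))
          + gap.hit (touched (remaining (h @ [w]))) T (last (h @ [w]))
          + total_cost (card (remaining (h @ [w])) div g - 1))"
        using stuck walk' unfolding stuck_bound_def by blast
      also have "\<dots> = ennreal (a + gap.hit ?S T w)"
        by (simp add: tr a_def algebra_simps)
      finally show ?thesis .
    qed
  qed
  have "(\<integral>\<^sup>+ w. uncovered_time E R T (h @ [w]) \<partial>measure_pmf (grw_step E R h))
      \<le> (\<integral>\<^sup>+ w. ennreal (a + gap.hit ?S T w) \<partial>measure_pmf (pmf_of_set (neighbors E ?X)))"
    using un N step unfolding grw_step_def
    by (auto intro!: nn_integral_mono_AE simp: AE_measure_pmf_iff set_pmf_of_set[OF N])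
  also have "\<dots> = (\<Sum>w\<in>neighbors E ?X. ennreal (a + gap.hit ?S T w)) / of_nat d"
    using N card_N by (simp add: nn_integral_pmf_of_set)
  also have "\<dots> = ennreal (\<Sum>w\<in>neighbors E ?X. a + gap.hit ?S T w) / ennreal (real d)"
    using a0 less gap.hit_nonneg by (subst sum_ennreal) (auto simp: ennreal_of_nat_eq_real_of_nat intro!: add_nonneg_nonneg)
  also have "\<dots> = ennreal ((\<Sum>w\<in>neighbors E ?X. a + gap.hit ?S T w) / real d)"
    using a0 less gap.hit_nonneg d_pos by (subst divide_ennreal) (auto intro!: sum_nonneg add_nonneg_nonneg)
  also have "(\<Sum>w\<in>neighbors E ?X. a + gap.hit ?S T w) / real d = a + gap.op (gap.hit ?S T) ?X"
    using d_pos by (simp add: mat_op_norm_adj[OF E(1) X] sum.distrib card_N add_divide_distrib)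
  finally have "uncovered_time E R (Suc T) h \<le> 1 + ennreal (a + gap.op (gap.hit ?S T) ?X)"
    by (simp add: indicator_def add_mono split: if_splits)
  also have "\<dots> = ennreal (a + gap.hit ?S (Suc T) ?X)"
  proof -
    have "gap.op (gap.hit ?S T) ?X \<ge> 0" using gap.op_nonneg gap.hit_nonneg X by blast
    then show ?thesis using XS a0 by (simp add: algebra_simps flip: ennreal_1 ennreal_plus)
  qed
  finally show "uncovered_time E R (Suc T) h \<le> ennreal (real (card ?U) + gap.hit ?S (Suc T) ?X
      + total_cost (card ?U div g - 1))"
    by (simp only: a_def add_ac)
qed

lemma greedy_bound_Suc:
  assumes stuck: "stuck_bound (Suc T)" and greedy: "greedy_bound T"
  shows "greedy_bound (Suc T)"
  unfolding greedy_bound_def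
proof (intro allI impI)
  fix h v P assume h: "walk h" and P: "P \<subseteq> traversed h"
    and par_P: "\<forall>x. odd (degree_in P x) \<longleftrightarrow> (x = v) \<noteq> (x = last h)"
    and par_U: "\<forall>x. odd (degree_in (remaining h) x) \<longleftrightarrow> (x = v) \<noteq> (x = last h)"
    and act: "P \<noteq> {} \<or> unused E h \<noteq> {}"
  let ?U = "remaining h" and ?X = "last h"
  let ?B = "real (card ?U) + total_cost ((card ?U + card P) div g - 1)"
  have PE: "P \<subseteq> E" using P h by (auto simp: walk_def)
  have fin: "finite P" "finite ?U" using finite_subset[OF PE] by auto
  have X: "?X < n" using h by (simp add: walk_def)
  show "uncovered_time E R (Suc T) h \<le> ennreal ?B"
  proof (cases "unused E h = {}")
    case True
    then have "degree_in ?U ?X = 0" using fin by (simp add: degree_in_eq_0_iff unused_empty_iff)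
    \<comment> \<open>Degree 0 at the current vertex is even, so the parity condition forces the two
      ends of the trail to coincide.\<close>
    then have "v = ?X" using par_U by (metis even_zero)
    then have even_U: "\<forall>x. even (degree_in ?U x)" and even_P: "\<And>x. even (degree_in P x)"
      using par_U par_P by auto
    have gP: "g \<le> card P" using girth_even_subgraph(1)[OF E(1) PE _ even_P] act True by auto
    show ?thesis
    proof (cases "?U = {}")
      case True
      then show ?thesis using covered_uncovered_time[OF h] by (simp del: uncovered_time.simps)
    next
      case False
      have gU: "g \<le> card ?U" using girth_even_subgraph(1)[OF E(1) _ False] even_U by auto
      define m where "m = card ?U div g"
      have m: "m \<ge> 1" using gU girth_bounds by (simp add: m_def Suc_le_eq div_greater_zero_iff)
      have "uncovered_time E R (Suc T) h
          \<le> ennreal (real (card ?U) + gap.hit (touched ?U) (Suc T) ?X + total_cost (m - 1))"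
        using stuck h False True even_U unfolding stuck_bound_def m_def by blast
      also have "\<dots> \<le> ennreal ?B"
      proof (rule ennreal_leI)
        have "gap.hit (touched ?U) (Suc T) ?X \<le> relocation_cost m"
          unfolding m_def by (rule hit_le_relocation_cost[OF _ False gU X]) auto
        moreover have "total_cost m = total_cost (m - 1) + relocation_cost m"
          using m by (cases m) (simp_all add: total_cost_def)
        \<comment> \<open>The finished phase contributes at least \<open>g\<close> edges, which
          raises the quotient to at least \<open>m + 1\<close>. The freed summand is
          \<open>relocation_cost m\<close> and pays for the random phase starting now.\<close>
        moreover have "total_cost m \<le> total_cost ((card ?U + card P) div g - 1)"
        proof (rule total_cost_mono)
          have "m + 1 = (card ?U + g) div g" using girth_bounds by (simp add: m_def)
          also have "\<dots> \<le> (card ?U + card P) div g" using gP by (intro div_le_mono) simp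
          finally show "m \<le> (card ?U + card P) div g - 1" by simp
        qed
        ultimately show "real (card ?U) + gap.hit (touched ?U) (Suc T) ?X + total_cost (m - 1) \<le> ?B"
          by linarith
      qed
      finally show ?thesis .
    qed
  next
    case False
    have "(\<integral>\<^sup>+ w. uncovered_time E R T (h @ [w]) \<partial>measure_pmf (grw_step E R h)) \<le> ennreal (?B - 1)"
    proof (rule nn_integral_pmf_le)
      fix w assume "w \<in> set_pmf (grw_step E R h)"
      moreover have "h \<noteq> []" using h by (simp add: walk_def)
      ultimately have "{?X, w} \<in> unused E h"
        using False rule unfolding grw_step_def admissible_rule_def by auto
      then have e: "{?X, w} \<in> E" "{?X, w} \<notin> traversed h" by (auto simp: unused_def)
      let ?e = "{?X, w}"
      let ?P' = "insert ?e P" and ?U' = "remaining (h @ [w])"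
      have Xw: "?X \<noteq> w" using simple_graph_edgeD[OF E(1) e(1)] by auto
      have tr: "traversed (h @ [w]) = insert ?e (traversed h)"
        using \<open>h \<noteq> []\<close> by (rule traversed_snoc)
      have U: "?U = insert ?e ?U'" "?e \<notin> ?U'" using e tr by auto
      have eP: "?e \<notin> P" using e P by auto
      have fin': "finite ?U'" by simp
      have card_U: "card ?U = Suc (card ?U')" using U fin' by (metis card_insert_disjoint)
      have deg_U: "degree_in ?U x = degree_in ?U' x + (if x \<in> ?e then 1 else 0)" for x
        using degree_in_insert[OF fin' U(2)] U(1) by metis
      have "uncovered_time E R T (h @ [w])
          \<le> ennreal (real (card ?U') + total_cost ((card ?U' + card ?P') div g - 1))"
      proof (rule greedy_boundD[OF greedy walk_snoc[OF h e(1)]])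
        show "?P' \<subseteq> traversed (h @ [w])" using P tr by auto
        fix x
        show "odd (degree_in ?P' x) \<longleftrightarrow> (x = v) \<noteq> (x = last (h @ [w]))"
          using par_P Xw by (auto simp: degree_in_insert[OF fin(1) eP])
        \<comment> \<open>Deleting the edge flips parity exactly at its two ends, so the moving odd
          end passes from \<open>?X\<close> to \<open>w\<close>.\<close>
        have "odd (degree_in ?U' x + (if x \<in> ?e then 1 else 0)) \<longleftrightarrow> (x = v) \<noteq> (x = ?X)"
          using par_U deg_U by metis
        then show "odd (degree_in ?U' x) \<longleftrightarrow> (x = v) \<noteq> (x = last (h @ [w]))"
          using Xw by (cases "x \<in> ?e") auto
      qed simp
      moreover have "card ?P' = Suc (card P)" using eP fin by simp
      ultimately show "uncovered_time E R T (h @ [w]) \<le> ennreal (?B - 1)"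
        using card_U by simp
    qed
    then have "uncovered_time E R (Suc T) h \<le> 1 + ennreal (?B - 1)"
      by (simp add: add_mono indicator_def)
    also have "\<dots> = ennreal ?B"
    proof -
      have "?U \<noteq> {}" using False by (auto simp: unused_def)
      then have "card ?U \<ge> 1" using fin by (simp add: Suc_le_eq card_gt_0_iff)
      then have "?B - 1 \<ge> 0" using total_cost_nonneg[of "(card ?U + card P) div g - 1"] by linarith
      then show ?thesis by (simp flip: ennreal_1 ennreal_plus)
    qed
    finally show ?thesis .
  qed
qed

lemma uncovered_time_le:
  assumes "v0 < n"
  shows "uncovered_time E R T [v0] \<le> ennreal (real (card E) + total_cost (card E div g))"
proof -
  have "stuck_bound T \<and> greedy_bound T"
  proof (induction T)
    case 0
    then show ?case by (simp add: stuck_bound_def greedy_bound_def)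
  next
    case (Suc T)
    then show ?case using stuck_bound_Suc greedy_bound_Suc by blast
  qed
  then have "greedy_bound T" by simp
  moreover have "walk [v0]" using assms by (simp add: walk_def traversed_singleton)
  moreover have "unused E [v0] \<noteq> {}"
  proof -
    have "degree_in E v0 \<noteq> 0" using assms d_pos by (simp add: degree_in_E)
    then show ?thesis by (simp add: unused_empty_iff traversed_singleton degree_in_eq_0_iff)
  qed
  moreover have "even (degree_in E x)" for x using even_d by (simp add: degree_in_E)
  ultimately have "uncovered_time E R T [v0] \<le> ennreal (real (card (remaining [v0]))
      + total_cost ((card (remaining [v0]) + card ({} :: nat set set)) div g - 1))"
    by (intro greedy_boundD[where v = v0]) (simp_all add: traversed_singleton, simp add: degree_in_def)
  also have "\<dots> \<le> ennreal (real (card E) + total_cost (card E div g))"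
    using total_cost_mono[of "card E div g - 1" "card E div g"]
    by (intro ennreal_leI) (simp add: traversed_singleton)
  finally show ?thesis .
qed

text \<open>There are \<open>M \<le> card E / g\<close> random phases. From
  \<open>M \<le> n ^ 2\<close> and \<open>1 \<le> 2 * ln n\<close> the harmonic sum is at most
  \<open>4 * ln n\<close>, whence 3 + 2 * 4 = 11.\<close>

lemma total_cost_le:
  "total_cost (card E div g) \<le> 11 * real (card E) * ln (real n) / ((1 - lam) * real g)"
proof -
  define M where "M = card E div g"
  have g0: "real g > 0" using girth_bounds by simp
  have l: "1 - lam > 0" using gap.lam_less_1 by simp
  have n0: "real n > 0" using two_le_n by simp
  have M1: "M \<ge> 1" using girth_bounds by (simp add: M_def Suc_le_eq div_greater_zero_iff)
  have Mg: "real M \<le> real (card E) / real g"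
    unfolding M_def by (rule of_nat_div_le_of_nat)
  have "d \<le> n"
    using card_neighbors[OF E, of 0] card_mono[OF _ neighbors_less[OF E(1)], of 0] two_le_n by simp
  have "M \<le> n ^ 2"
  proof -
    have "M \<le> card E" by (simp add: M_def)
    also have "\<dots> \<le> n * d" using two_card_E by linarith
    also have "\<dots> \<le> n ^ 2" using \<open>d \<le> n\<close> by (simp add: power2_eq_square)
    finally show ?thesis .
  qed
  then have "ln (real M) \<le> ln (real (n ^ 2))" using M1 two_le_n by (subst ln_le_cancel_iff) auto
  also have "\<dots> = 2 * ln (real n)" using n0 by (simp add: ln_realpow)
  finally have lnM: "ln (real M) \<le> 2 * ln (real n)" .
  have "ln 2 \<le> ln (real n)" using two_le_n by simp
  then have half: "1 \<le> 2 * ln (real n)" using ln2_ge_two_thirds by linarith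
  have "total_cost M = (\<Sum>j=1..M. 3 * ln (real n) / (1 - lam) + 2 * real (card E) / (real g * (1 - lam)) * (1 / real j))"
    unfolding total_cost_def relocation_cost_def
    by (intro sum.cong refl) (simp add: add_divide_distrib mult_ac)
  also have "\<dots> = real M * (3 * ln (real n) / (1 - lam)) + 2 * real (card E) / (real g * (1 - lam)) * (\<Sum>j=1..M. 1 / real j)"
    by (simp add: sum.distrib sum_distrib_left)
  also have "\<dots> \<le> real (card E) / real g * (3 * ln (real n) / (1 - lam))
      + 2 * real (card E) / (real g * (1 - lam)) * (4 * ln (real n))"
    using sum_inverse_le[OF M1] lnM half Mg l g0 two_le_n
    by (intro add_mono mult_right_mono mult_left_mono) auto
  also have "\<dots> = 11 * real (card E) * ln (real n) / ((1 - lam) * real g)"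
  proof -
    have "c / real g * (3 * b / q) + 2 * c / (real g * q) * (4 * b) = 11 * c * b / (q * real g)"
      if "q > 0" for b c q :: real
      using that g0 by (simp add: field_simps)
    from this[OF l] show ?thesis .
  qed
  finally show ?thesis by (simp add: M_def)
qed

lemma expected_edge_cover_time_bound:
  assumes "v0 < n"
  shows "expected_edge_cover_time E R v0
    \<le> ennreal (real (card E) + 11 * real (card E) * ln (real n) / ((1 - lam) * real g))"
proof (rule expected_edge_cover_time_le)
  fix T
  show "uncovered_time E R T [v0]
      \<le> ennreal (real (card E) + 11 * real (card E) * ln (real n) / ((1 - lam) * real g))"
    by (rule order.trans[OF uncovered_time_le[OF assms] ennreal_leI]) (use total_cost_le in simp)
qed

end

text \<open>Serves degree 0, where the adjacency matrix is zero and hence not stochastic. The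
  history of one vertex has traversed nothing, which is already every edge.\<close>

lemma expected_edge_cover_time_empty: "expected_edge_cover_time {} R v0 = 0"
proof -
  have "\<not> not_covered_by {} t h" if "h \<in> set_pmf (grw {} R v0 t)" for t h
  proof -
    have "length (take (Suc 0) h) = 1" using length_grw[OF that] by simp
    then obtain x where "take (Suc 0) h = [x]" by (metis One_nat_def length_Suc_conv length_0_conv)
    then show ?thesis unfolding not_covered_by_def by (auto simp: traversed_singleton)
  qed
  then have "measure_pmf.prob (grw {} R v0 t) {h. not_covered_by {} t h} = 0" for t
    by (auto simp: measure_pmf_zero_iff)
  then show ?thesis by (simp add: expected_edge_cover_time_def)
qed

theorem mainTheorem5:
  "\<exists>C::real. C > 0 \<and>
    (\<forall>(n::nat) (d::nat) (lam::real) (E::nat set set) (g::nat)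
        (R::nat list \<Rightarrow> nat pmf) (v0::nat).
       expander n E d lam \<longrightarrow> n \<ge> 2 \<longrightarrow> even d \<longrightarrow> girth E = g \<longrightarrow>
       admissible_rule E R \<longrightarrow> v0 < n \<longrightarrow>
       expected_edge_cover_time E R v0 \<le>
         ennreal (real (card E) + C * real (card E) * ln (real n) / ((1 - lam) * real g)))"
proof (intro exI[of _ "11::real"] conjI allI impI)
  fix n d lam E g R and v0 :: nat
  assume A: "expander n E d lam" "n \<ge> 2" "even d" "girth E = g" "admissible_rule E R" "v0 < n"
  show "expected_edge_cover_time E R v0 \<le>
         ennreal (real (card E) + 11 * real (card E) * ln (real n) / ((1 - lam) * real g))"
  proof (cases "d = 0")
    case True
    have "2 * card E \<le> d * card (touched E)"
      using A(1) by (intro card_edges_le_touched) (auto simp: expander_def)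
    then have "E = {}" using True A(1) simple_graph_finite by (auto simp: expander_def)
    then show ?thesis by (simp add: expected_edge_cover_time_empty)
  next
    case False
    interpret greedy_walk n d lam E R using A False by unfold_locales auto
    show ?thesis using expected_edge_cover_time_bound[OF A(6)] A(4) by simp
  qed
qed simp

end
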